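(* There exist constants $C_\Lambda>0$ and $D_\Lambda>0$, not depending on $n$ and $p$, such that for all positive integers $n,p$ with $n$ and $n+p$ relatively prime the Lebesgue constant $\Lambda_{n,p}$ satisfies $$D_\Lambda\ln^2(n)\le\Lambda_{n,p}\le C_\Lambda\ln^2(n+p).$$
   Context: For positive integers $n,p$ with $n$ and $n+p$ relatively prime: $\gamma_{n,p}(t) = (\cos(nt),\cos((n+p)t))$ and $\mathrm{LD}_{n,p} := \{\gamma_{n,p}(\frac{\pi k}{n(n+p)}): k=0,\ldots,n(n+p)\}\subset[-1,1]^2$. With $T_i(x)=\cos(i\arccos x)$, $\Gamma_{n,p} := \{(i,j)\in\mathbb{N}_0^2: \frac{i}{n+p}+\frac jn<1\}$ and $\Gamma_{n,p}^L := \Gamma_{n,p}\cup\{(0,n)\}$, put $\Pi_{n,p}^{2,L} := \mathrm{span}\{T_i(x)T_j(y): (i,j)\in\Gamma_{n,p}^L\}$. It is known that interpolation on $\mathrm{LD}_{n,p}$ is uniquely solvable in $\Pi_{n,p}^{2,L}$; let $L_{\mathcal{A}}\in\Pi_{n,p}^{2,L}$, $\mathcal{A}\in\mathrm{LD}_{n,p}$, be the fundamental Lagrange polynomials, $L_{\mathcal{A}}(\mathcal{B})=\delta_{\mathcal{A},\mathcal{B}}$ for $\mathcal{A},\mathcal{B}\in\mathrm{LD}_{n,p}$. Explicitly, with $\hat T_0=1$ and $\hat T_i=\sqrt2\,T_i$ for $i\ge1$, $$L_{\mathcal{A}}(x,y)=w_{\mathcal{A}}\Big(\sum_{(i,j)\in\Gamma_{n,p}}\hat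 T_i(x)\hat T_i(x_{\mathcal{A}})\hat T_j(y)\hat T_j(y_{\mathcal{A}})+\tfrac12\hat T_n(y)\hat T_n(y_{\mathcal{A}})\Big),$$ where $w_{\mathcal{A}} = \frac{1}{2n(n+p)}$ if $\mathcal{A}\in\{\gamma_{n,p}(0),\gamma_{n,p}(\pi)\}$, $w_{\mathcal{A}}=\frac{1}{n(n+p)}$ for the other nodes on the boundary of $[-1,1]^2$, and $w_{\mathcal{A}}=\frac{2}{n(n+p)}$ for nodes in the interior. The Lebesgue constant is $$\Lambda_{n,p} := \max_{(x,y)\in[-1,1]^2}\sum_{\mathcal{A}\in\mathrm{LD}_{n,p}}|L_{\mathcal{A}}(x,y)|,$$ i.e. the operator norm of the interpolation operator $f\mapsto\sum_{\mathcal{A}\in\mathrm{LD}_{n,p}}f(\mathcal{A})L_{\mathcal{A}}$ on $(C([-1,1]^2),\|\cdot\|_\infty)$. *)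

theory Defs
  imports Complex_Main
begin

definition lissajous :: "nat \<Rightarrow> nat \<Rightarrow> real \<Rightarrow> real \<times> real" where
  "lissajous n p t = (cos (real n * t), cos (real (n + p) * t))"

(* Self-intersection points of the curve are hit by two different k but occur once in this set. *)
definition LD :: "nat \<Rightarrow> nat \<Rightarrow> (real \<times> real) set" where
  "LD n p = (\<lambda>k. lissajous n p (pi * real k / real (n * (n + p)))) ` {0..n * (n + p)}"

(* The Chebyshev polynomial of degree i on [-1,1]. Outside [-1,1] arccos is unspecified; no value
   there enters the interpolation conditions or the Lebesgue constant. *)
definition Cheb :: "nat \<Rightarrow> real \<Rightarrow> real" where
  "Cheb i x = cos (real i * arccos x)"

definition Gam :: "nat \<Rightarrow> nat \<Rightarrow> (nat \<times> nat) set" where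
  "Gam n p = {(i, j). real i / real (n + p) + real j / real n < 1}"

definition GamL :: "nat \<Rightarrow> nat \<Rightarrow> (nat \<times> nat) set" where
  "GamL n p = Gam n p \<union> {(0, n)}"

(* The linear span of the products T_i(x) T_j(y), (i,j) in GamL n p. The index set is finite for
   n > 0, so the span consists of the linear combinations over the whole index set. *)
definition PiL :: "nat \<Rightarrow> nat \<Rightarrow> (real \<times> real \<Rightarrow> real) set" where
  "PiL n p = {f. \<exists>c :: nat \<times> nat \<Rightarrow> real.
     f = (\<lambda>(x, y). \<Sum>(i, j)\<in>GamL n p. c (i, j) * (Cheb i x * Cheb j y))}"

definition is_lagrange :: "nat \<Rightarrow> nat \<Rightarrow> real \<times> real \<Rightarrow> (real \<times> real \<Rightarrow> real) \<Rightarrow> bool" where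
  "is_lagrange n p A f \<longleftrightarrow>
     f \<in> PiL n p \<and> (\<forall>B\<in>LD n p. f B = (if B = A then 1 else 0))"

(* The description is proper because interpolation on LD n p is uniquely solvable in PiL n p
   whenever n, p > 0 and n, n + p are coprime. *)
definition lagrange :: "nat \<Rightarrow> nat \<Rightarrow> real \<times> real \<Rightarrow> real \<times> real \<Rightarrow> real" where
  "lagrange n p A = (THE f. is_lagrange n p A f)"

(* The supremum is a maximum: the Lebesgue function is continuous on the compact square. *)
definition lebesgue_const :: "nat \<Rightarrow> nat \<Rightarrow> real" where
  "lebesgue_const n p = (SUP z \<in> {-1..1} \<times> {-1..1}. \<Sum>A\<in>LD n p. \<bar>lagrange n p A z\<bar>)"

end

theory Submission
  imports Defs "HOL-Analysis.Harmonic_Numbers" "HOL-Number_Theory.Cong"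
begin

text \<open>
  With \<open>m = n + p\<close>, the nodes are the points \<open>(cos (a pi / m), cos (b pi / n))\<close> with \<open>a + b\<close> even, so
  Lagrange polynomials come from the discrete orthogonality of cosines, and the Lebesgue function is
  an average over the grid of absolute values of the Dirichlet kernel \<open>D(s, t)\<close> of the triangle with legs
  \<open>m\<close> and \<open>n\<close>.

  Upper bound: summing \<open>D\<close> along the rows gives \<open>1 / sin (s/2)\<close> times an exponential sum whose phases
  are linear up to a remainder modulo \<open>n\<close>. A finite Fourier expansion in that remainder turns
  the sum into a superposition of shifted one-dimensional Dirichlet kernels with coefficients of
  logarithmic total mass; averaging in \<open>t\<close> and then in \<open>s\<close> yields one logarithm each. For small \<open>s\<close>
  the kernel is summed along the columns instead.

  Lower bound: at \<open>(1, cos (pi / n))\<close> and for about \<open>n\<close> nodes near the corner \<open>(1, 1)\<close> the rows may be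
  replaced by their linear approximation, for which the kernel has a closed form without
  cancellation. The resulting sum is comparable to that of \<open>1 / (a y)\<close> over \<open>y \<le> a \<le> sqrt n\<close>.
\<close>

section \<open>Discrete orthogonality of cosines\<close>

text \<open>Trapezoidal weights on \<open>0..N\<close>. They act as quadrature weights on the nodes
  and, by duality, as normalising factors of the frequencies.\<close>

definition hw :: "nat \<Rightarrow> nat \<Rightarrow> real" where
  "hw N i = (if i = 0 \<or> i = N then 1/2 else 1)"

definition h0 :: "nat \<Rightarrow> real" where
  "h0 i = (if i = 0 then 1/2 else 1)"

lemma hw_pos: "hw N i > 0"
  by (simp add: hw_def)

lemma sum_hw:
  assumes "N > 0"
  shows "(\<Sum>a\<le>N. hw N a * f a) = (\<Sum>a<N. f a) - f 0 / 2 + f N / 2"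
proof -
  obtain M where N: "N = Suc M" using assms gr0_implies_Suc by blast
  have "(\<Sum>a\<le>N. hw N a * f a) = (\<Sum>a<N. hw N a * f a) + f N / 2"
    by (simp add: lessThan_Suc_atMost[symmetric] hw_def)
  also have "(\<Sum>a<N. hw N a * f a) = (\<Sum>a<N. f a) - f 0 / 2"
    unfolding N sum.lessThan_Suc_shift by (simp add: hw_def)
  finally show ?thesis .
qed

lemma sum_h0:
  assumes "N > 0"
  shows "(\<Sum>a<N. h0 a * f a) = (\<Sum>a<N. f a) - f 0 / 2"
proof -
  obtain M where N: "N = Suc M" using assms gr0_implies_Suc by blast
  show ?thesis unfolding N sum.lessThan_Suc_shift by (simp add: h0_def)
qed

text \<open>Telescoping after the product-to-sum formula. The sine is kept as a factor, so that its
  zeros need no separate case.\<close>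

lemma sum_cos:
  "2 * sin (x/2) * (\<Sum>a<N. cos (real a * x)) = sin ((real N - 1/2) * x) + sin (x/2)"
proof (induction N)
  case 0
  have "(0 - 1/2) * x = - (x/2)" by simp
  then show ?case by (simp only: sin_minus of_nat_0) simp
next
  case (Suc N)
  have "2 * sin (x/2) * cos (real N * x) = sin ((real (Suc N) - 1/2) * x) - sin ((real N - 1/2) * x)"
  proof -
    have e: "(real (Suc N) - 1/2) * x = real N * x + x/2" "(real N - 1/2) * x = real N * x - x/2"
      by (simp_all add: algebra_simps add_divide_distrib)
    show ?thesis unfolding e sin_add sin_diff by simp
  qed
  then show ?case using Suc by (simp add: distrib_left)
qed

text \<open>Halving both end terms leaves the factor \<open>sin (N x)\<close>, which vanishes at
  every grid point \<open>x = k pi / N\<close>.\<close>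

lemma trapezoid_cos:
  assumes "N > 0"
  shows "2 * sin (x/2) * (\<Sum>a\<le>N. hw N a * cos (real a * x)) = sin (real N * x) * cos (x/2)"
proof -
  have e: "(real N - 1/2) * x = real N * x - x/2"
    by (simp add: algebra_simps)
  have "2 * sin (x/2) * (\<Sum>a\<le>N. hw N a * cos (real a * x))
     = 2 * sin (x/2) * (\<Sum>a<N. cos (real a * x)) - sin (x/2) + sin (x/2) * cos (real N * x)"
    unfolding sum_hw[OF assms] by (simp add: algebra_simps)
  then show ?thesis unfolding sum_cos e sin_diff by simp
qed

lemma half_dirichlet:
  assumes "K > 0"
  shows "2 * sin (x/2) * (\<Sum>a<K. h0 a * cos (real a * x)) = sin ((real K - 1/2) * x)"
proof -
  have "2 * sin (x/2) * (\<Sum>a<K. h0 a * cos (real a * x))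
     = 2 * sin (x/2) * (\<Sum>a<K. cos (real a * x)) - sin (x/2)"
    unfolding sum_h0[OF assms] by (simp add: algebra_simps)
  then show ?thesis unfolding sum_cos by simp
qed

lemma trapezoid_cos_grid:
  assumes N: "N > 0" and k: "k \<le> 2 * N"
  shows "(\<Sum>a\<le>N. hw N a * cos (real a * (real k * pi / real N))) = (if k = 0 \<or> k = 2 * N then real N else 0)"
proof (cases "k = 0 \<or> k = 2 * N")
  case True
  have c: "cos (real a * (real k * pi / real N)) = 1" for a
    using True
  proof
    assume "k = 2 * N"
    then have "real a * (real k * pi / real N) = 2 * real a * pi" using N by simp
    also have "cos \<dots> = 1" using cos_2npi by blast
    finally show ?thesis .
  qed simp
  have "(\<Sum>a\<le>N. hw N a * 1) = real N" unfolding sum_hw[OF N] by simp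
  then show ?thesis unfolding c using True by simp
next
  case False
  define x where "x = real k * pi / real N"
  have "0 < x/2" using False N by (simp add: x_def)
  moreover have "x/2 < pi"
  proof -
    have "real k < 2 * real N" using False k by linarith
    then show ?thesis using N by (simp add: x_def field_simps)
  qed
  ultimately have s: "sin (x/2) > 0" by (rule sin_gt_zero)
  have "real N * x = real k * pi" using N by (simp add: x_def)
  then have "sin (real N * x) = 0" by simp
  then have "2 * sin (x/2) * (\<Sum>a\<le>N. hw N a * cos (real a * x)) = 0"
    using trapezoid_cos[OF N, of x] by simp
  then show ?thesis using s False by (simp add: x_def)
qed

text \<open>The product formula yields the frequencies \<open>i - i'\<close> and
  \<open>i + i'\<close>. For \<open>i = i'\<close> in \<open>{0, N}\<close> both contribute, which
  the factor \<open>1 / hw N i\<close> records.\<close>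

lemma cos_grid_orthogonal:
  assumes N: "N > 0" and i: "i \<le> N" "i' \<le> N"
  shows "(\<Sum>a\<le>N. hw N a * (cos (real i * (real a * pi / real N)) * cos (real i' * (real a * pi / real N))))
    = (if i = i' then real N / (2 * hw N i) else 0)"
  using i
proof (induction i i' rule: linorder_wlog)
  case (sym a b)
  then show ?case by (auto simp: mult.commute)
next
  case (le i' i)
  have "(\<Sum>a\<le>N. hw N a * (cos (real i' * (real a * pi / real N)) * cos (real i * (real a * pi / real N))))
     = (\<Sum>a\<le>N. hw N a * cos (real a * (real (i - i') * pi / real N)) / 2
          + hw N a * cos (real a * (real (i + i') * pi / real N)) / 2)"
  proof (rule sum.cong[OF refl])
    fix a
    have e: "real a * (real (i - i') * pi / real N) = real i * (real a * pi / real N) - real i' * (real a * pi / real N)"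
      "real a * (real (i + i') * pi / real N) = real i * (real a * pi / real N) + real i' * (real a * pi / real N)"
      using le(1) N by (simp_all add: field_simps of_nat_diff)
    have "h * (p * q) = h * (q * p + r) / 2 + h * (q * p - r) / 2" for h p q r :: real
      by (simp add: field_simps)
    then show "hw N a * (cos (real i' * (real a * pi / real N)) * cos (real i * (real a * pi / real N)))
      = hw N a * cos (real a * (real (i - i') * pi / real N)) / 2
          + hw N a * cos (real a * (real (i + i') * pi / real N)) / 2"
      unfolding e cos_add cos_diff .
  qed
  also have "\<dots> = (\<Sum>a\<le>N. hw N a * cos (real a * (real (i - i') * pi / real N))) / 2
      + (\<Sum>a\<le>N. hw N a * cos (real a * (real (i + i') * pi / real N))) / 2"
    by (simp only: sum.distrib sum_divide_distrib)
  also have "\<dots> = (if i' = i then real N / (2 * hw N i') else 0)"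
  proof -
    have b: "i - i' \<le> 2 * N" "i + i' \<le> 2 * N" using le by auto
    show ?thesis unfolding trapezoid_cos_grid[OF N b(1)] trapezoid_cos_grid[OF N b(2)]
      using le N by (auto simp: hw_def)
  qed
  finally show ?case .
qed

section \<open>The nodes as one parity class of a grid\<close>

definition even_grid :: "nat \<Rightarrow> nat \<Rightarrow> (nat \<times> nat) set" where
  "even_grid m n = {(a, b). a \<le> m \<and> b \<le> n \<and> even (a + b)}"

definition node :: "nat \<Rightarrow> nat \<Rightarrow> nat \<times> nat \<Rightarrow> real \<times> real" where
  "node m n = (\<lambda>(a, b). (cos (real a * pi / real m), cos (real b * pi / real n)))"

lemma finite_even_grid: "finite (even_grid m n)"
  by (rule finite_subset[of _ "{..m} \<times> {..n}"]) (auto simp: even_grid_def)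

lemma cos_grid_inj:
  assumes "m > 0" "a \<le> m" "a' \<le> m" "cos (real a * pi / real m) = cos (real a' * pi / real m)"
  shows "a = a'"
proof -
  have "real a * pi / real m \<le> pi" "real a' * pi / real m \<le> pi"
    using assms by (auto simp: field_simps)
  then have "real a * pi / real m = real a' * pi / real m"
    using assms(4) cos_inj_pi[of "real a * pi / real m" "real a' * pi / real m"] by simp
  then show ?thesis using assms(1) by simp
qed

lemma inj_on_node:
  assumes "m > 0" "n > 0"
  shows "inj_on (node m n) (even_grid m n)"
  using assms cos_grid_inj by (fastforce simp: inj_on_def node_def even_grid_def)

text \<open>Folding by the period \<open>2 * N\<close> and by evenness of the cosine both preserve
  the parity of \<open>k\<close>; this is the origin of the parity condition in
  \<open>even_grid\<close>.\<close>

lemma cos_grid_reduce: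
  assumes N: "N > 0"
  obtains i where "i \<le> N" "even (i + k)" "cos (real k * pi / real N) = cos (real i * pi / real N)"
proof -
  define r where "r = k mod (2 * N)"
  have r: "r < 2 * N" using N by (simp add: r_def)
  have k: "k = r + 2 * N * (k div (2 * N))" by (simp add: r_def)
  have ev: "even (r + k)" by (simp add: r_def dvd_mod_iff)
  have "real k * pi / real N = real r * pi / real N + 2 * real (k div (2 * N)) * pi"
    by (subst k) (use N in \<open>simp add: field_simps\<close>)
  then have c: "cos (real k * pi / real N) = cos (real r * pi / real N)"
    using sin_npi[of "2 * (k div (2 * N))"] cos_npi[of "2 * (k div (2 * N))"]
    by (simp add: cos_add cos_2npi sin_2npi mult.assoc)
  show ?thesis
  proof (cases "r \<le> N")
    case True
    then show ?thesis using that[of r] ev c by simp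
  next
    case False
    have "real (2 * N - r) * pi / real N = 2 * pi - real r * pi / real N"
      using r N by (simp add: field_simps of_nat_diff)
    then have "cos (real (2 * N - r) * pi / real N) = cos (real r * pi / real N)" by simp
    moreover have "even (2 * N - r + k)" using ev r by presburger
    ultimately show ?thesis using that[of "2 * N - r"] c False by simp
  qed
qed

text \<open>The period in the numerator is \<open>2 * N\<close>, but with the parity
  \<open>e\<close> split off a congruence modulo \<open>N\<close> suffices. Thus the Chinese
  remainder theorem can be used with the coprime moduli \<open>m\<close> and \<open>n\<close>,
  whereas \<open>2 * m\<close> and \<open>2 * n\<close> share a factor.\<close>

lemma cos_grid_cong:
  assumes N: "N > 0" and c: "[y = y'] (mod N)"
  shows "cos (real (2 * y + e) * pi / real N) = cos (real (2 * y' + e) * pi / real N)"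
proof -
  have red: "cos (real (2 * z + e) * pi / real N) = cos (real (2 * (z mod N) + e) * pi / real N)" for z
  proof -
    have "real z = real (z mod N) + real N * real (z div N)"
      by (metis mod_mult_div_eq of_nat_add of_nat_mult)
    then have "real (2 * z + e) * pi / real N = real (2 * (z mod N) + e) * pi / real N + 2 * real (z div N) * pi"
      using N by (simp add: field_simps)
    then show ?thesis
      by (simp add: cos_add cos_2npi sin_2npi)
  qed
  show ?thesis using red[of y] red[of y'] c by (simp add: cong_def)
qed

text \<open>\<open>cos (k x)\<close> is a polynomial in \<open>cos x\<close>; the induction follows
  the Chebyshev recurrence.\<close>

lemma cos_multiple_cong:
  fixes x y :: real
  assumes "cos x = cos y"
  shows "cos (real k * x) = cos (real k * y)"
proof (induction k rule: less_induct)
  case (less k)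
  have rec: "cos (real (Suc (Suc j)) * z) = 2 * cos z * cos (real (Suc j) * z) - cos (real j * z)" for j and z :: real
  proof -
    have e: "real (Suc (Suc j)) * z = real (Suc j) * z + z" "real j * z = real (Suc j) * z - z"
      by (simp_all add: algebra_simps)
    show ?thesis unfolding e cos_add cos_diff by simp
  qed
  consider "k = 0" | "k = 1" | j where "k = Suc (Suc j)"
    by (metis One_nat_def not0_implies_Suc)
  then show ?case
  proof cases
    case 1
    then show ?thesis by simp
  next
    case 2
    then show ?thesis using assms by simp
  next
    case 3
    then show ?thesis using less[of j] less[of "Suc j"] assms by (simp only: rec)
  qed
qed

lemma LD_eq_node_image:
  assumes n: "n > 0" and cop: "coprime n (n + p)"
  shows "LD n p = node (n + p) n ` even_grid (n + p) n"
proof -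
  define m where "m = n + p"
  have m: "m > 0" using n by (simp add: m_def)
  have curve: "lissajous n p (pi * real k / real (n * m)) = (cos (real k * pi / real m), cos (real k * pi / real n))" for k
    using n m by (simp add: lissajous_def m_def[symmetric] field_simps)
  show ?thesis unfolding m_def[symmetric]
  proof (intro equalityI subsetI)
    fix z assume "z \<in> LD n p"
    then obtain k where z: "z = (cos (real k * pi / real m), cos (real k * pi / real n))"
      unfolding LD_def m_def[symmetric] curve by auto
    obtain i where i: "i \<le> m" "even (i + k)" "cos (real k * pi / real m) = cos (real i * pi / real m)"
      using cos_grid_reduce[OF m] .
    obtain j where j: "j \<le> n" "even (j + k)" "cos (real k * pi / real n) = cos (real j * pi / real n)"
      using cos_grid_reduce[OF n] .
    have "(i, j) \<in> even_grid m n" using i j by (simp add: even_grid_def)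
    moreover have "z = node m n (i, j)" using z i j by (simp add: node_def)
    ultimately show "z \<in> node m n ` even_grid m n" by blast
  next
    fix z assume "z \<in> node m n ` even_grid m n"
    then obtain a b where ab: "even (a + b)" and z: "z = (cos (real a * pi / real m), cos (real b * pi / real n))"
      by (auto simp: even_grid_def node_def)
    have "coprime m n" using cop by (simp add: m_def coprime_commute)
    \<comment> \<open>\<open>a\<close> and \<open>b\<close> have the same parity, so it is enough to
      match their halves; the common parity is restored in \<open>x\<close>.\<close>
    then obtain y where y: "[y = a div 2] (mod m)" "[y = b div 2] (mod n)"
      using binary_chinese_remainder_nat by blast
    define x where "x = 2 * y + a mod 2"
    have par: "2 * (b div 2) + a mod 2 = b" using ab by presburger
    have xa: "cos (real x * pi / real m) = cos (real a * pi / real m)"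
      using cos_grid_cong[OF m y(1), of "a mod 2"] by (simp add: x_def)
    have xb: "cos (real x * pi / real n) = cos (real b * pi / real n)"
      using cos_grid_cong[OF n y(2), of "a mod 2"] unfolding par x_def .
    have "n * m > 0" using n m by simp
    then obtain k where k: "k \<le> n * m" "cos (real x * pi / real (n * m)) = cos (real k * pi / real (n * m))"
      by (rule cos_grid_reduce)
    \<comment> \<open>\<open>x\<close> may lie beyond \<open>n * m\<close>. Equal cosines at the
      angles over \<open>n * m\<close> pass to the multiples by \<open>n\<close> and
      \<open>m\<close>, which are the angles of the two coordinates.\<close>
    have "cos (real x * pi / real m) = cos (real k * pi / real m)"
      using cos_multiple_cong[OF k(2), of n] n m by simp
    moreover have "cos (real x * pi / real n) = cos (real k * pi / real n)"
      using cos_multiple_cong[OF k(2), of m] n m by simp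
    ultimately have "z = lissajous n p (pi * real k / real (n * m))"
      unfolding curve z using xa xb by simp
    then show "z \<in> LD n p" using k(1) unfolding LD_def m_def[symmetric] by auto
  qed
qed

lemma Gam_iff:
  assumes "n > 0"
  shows "(i, j) \<in> Gam n p \<longleftrightarrow> i * n + j * (n + p) < (n + p) * n"
proof -
  define m where "m = n + p"
  have m: "m > 0" using assms by (simp add: m_def)
  have "real i / real m + real j / real n = real (i * n + j * m) / real (m * n)"
    using assms m by (simp add: field_simps)
  also have "\<dots> < 1 \<longleftrightarrow> i * n + j * m < m * n"
    using assms m by (simp add: divide_less_eq del: of_nat_mult of_nat_add)
  finally show ?thesis by (simp add: Gam_def m_def)
qed

section \<open>The frequency triangle and the Lagrange polynomials\<close>

text \<open>Free of subtraction and division, and symmetric under exchanging \<open>m\<close> with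
  \<open>n\<close> together with the coordinates; the upper bound reads the triangle both by rows
  and by columns.\<close>

definition tri :: "nat \<Rightarrow> nat \<Rightarrow> (nat \<times> nat) set" where
  "tri m n = {(i, j). i * n + j * m < m * n}"

lemma tri_bounds:
  assumes "(i, j) \<in> tri m n"
  shows "i < m" "j < n"
proof -
  have h: "i * n + j * m < m * n" using assms by (simp add: tri_def)
  have "i * n < m * n" using h by linarith
  moreover have "j * m < n * m" using h by (metis add_lessD1 add.commute mult.commute)
  ultimately show "i < m" "j < n" by simp_all
qed

lemma GamL_eq:
  assumes "n > 0"
  shows "GamL n p = insert (0, n) (tri (n + p) n)"
  using Gam_iff[OF assms] by (auto simp: GamL_def tri_def)

lemma finite_tri: "finite (tri m n)"
  by (rule finite_subset[of _ "{..m} \<times> {..n}"]) (auto dest: tri_bounds)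

lemma corner_notin_tri: "(0, n) \<notin> tri m n"
  by (simp add: tri_def mult.commute)

text \<open>On the even grid the frequencies \<open>(i, j)\<close> and \<open>(m - i, n - j)\<close> alias. The triangle together with the
  corner \<open>(0, n)\<close> contains exactly one frequency of each such pair: by coprimality the only
  lattice points on the hypotenuse are the two corners, which are interchanged.\<close>

definition flip :: "nat \<Rightarrow> nat \<Rightarrow> nat \<times> nat \<Rightarrow> nat \<times> nat" where
  "flip m n = (\<lambda>(i, j). (m - i, n - j))"

lemma coprime_hypotenuse:
  fixes m n i j :: nat
  assumes cop: "coprime m n" and h: "i * n + j * m = m * n" and b: "i \<le> m" "j \<le> n" and "m > 0" "n > 0"
  shows "(i, j) = (0, n) \<or> (i, j) = (m, 0)"
proof -
  have "m dvd i * n + j * m" unfolding h by simp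
  then have "m dvd i * n" by (simp add: dvd_add_left_iff)
  then have "m dvd i" using cop by (simp add: coprime_dvd_mult_left_iff)
  then have "i = 0 \<or> i = m" using b(1) by (metis dvd_imp_le le_antisym not_gr_zero)
  then show ?thesis
  proof
    assume "i = 0"
    then have "j * m = n * m" using h by (simp add: mult.commute)
    then show ?thesis using \<open>i = 0\<close> \<open>m > 0\<close> by simp
  next
    assume "i = m"
    then have "j * m = 0" using h by simp
    then show ?thesis using \<open>i = m\<close> \<open>m > 0\<close> by simp
  qed
qed

lemma rectangle_fold:
  assumes cop: "coprime m n" and mn: "m > 0" "n > 0"
  defines "R \<equiv> insert (0, n) (tri m n)"
  shows "{..m} \<times> {..n} = R \<union> flip m n ` R" "R \<inter> flip m n ` R = {}" "inj_on (flip m n) R"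
proof -
  have bd: "fst z \<le> m \<and> snd z \<le> n" if "z \<in> R" for z
  proof (cases "z = (0, n)")
    case False
    then have "(fst z, snd z) \<in> tri m n" using that by (simp add: R_def)
    then show ?thesis using tri_bounds less_imp_le by blast
  qed simp
  \<comment> \<open>The values of \<open>i * n + j * m\<close> at a point and at its flip add up to
    \<open>2 * m * n\<close>: either exactly one of the two points lies below the hypotenuse, or
    both lie on it.\<close>
  have flip_val: "(m - i) * n + (n - j) * m + (i * n + j * m) = 2 * (m * n)" if ij: "i \<le> m" "j \<le> n" for i j
  proof -
    obtain i' where i': "m = i + i'" using le_Suc_ex[OF ij(1)] by blast
    obtain j' where j': "n = j + j'" using le_Suc_ex[OF ij(2)] by blast
    show ?thesis by (simp add: i' j' algebra_simps)
  qed
  show "inj_on (flip m n) R"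
  proof (rule inj_onI)
    fix z w assume "z \<in> R" "w \<in> R" "flip m n z = flip m n w"
    then show "z = w" using bd[of z] bd[of w] by (cases z; cases w) (auto simp: flip_def)
  qed
  show "R \<inter> flip m n ` R = {}"
  proof -
    have "flip m n z \<notin> R" if "z \<in> R" for z
    proof
      assume f: "flip m n z \<in> R"
      obtain i j where z: "z = (i, j)" by (cases z)
      have b: "i \<le> m" "j \<le> n" using bd[OF that] z by auto
      have v: "i * n + j * m \<le> m * n" using that by (auto simp: R_def z tri_def)
      have v': "(m - i) * n + (n - j) * m \<le> m * n" using f by (auto simp: R_def z tri_def flip_def)
      have "i * n + j * m = m * n" "(m - i) * n + (n - j) * m = m * n"
        using v v' flip_val[OF b] by linarith+
      then have "(i, j) = (0, n)" "flip m n z = (0, n)"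
        using that f by (auto simp: R_def z tri_def flip_def)
      then show False using mn by (simp add: z flip_def)
    qed
    then show ?thesis by auto
  qed
  show "{..m} \<times> {..n} = R \<union> flip m n ` R"
  proof (intro equalityI subsetI)
    fix z assume "z \<in> {..m} \<times> {..n}"
    then obtain i j where z: "z = (i, j)" and b: "i \<le> m" "j \<le> n" by auto
    have ff: "z = flip m n (flip m n z)" using z b by (simp add: flip_def)
    consider "i * n + j * m < m * n" | "i * n + j * m = m * n" | "i * n + j * m > m * n" by linarith
    then show "z \<in> R \<union> flip m n ` R"
    proof cases
      case 1 then show ?thesis by (simp add: R_def tri_def z)
    next
      case 2
      have "(i, j) = (0, n) \<or> (i, j) = flip m n (0, n)"
        using coprime_hypotenuse[OF cop 2 b mn] by (simp add: flip_def)
      then show ?thesis by (auto simp: R_def z)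
    next
      case 3
      then have "flip m n z \<in> R" using flip_val[OF b] by (simp add: R_def tri_def z flip_def)
      then show ?thesis using ff by blast
    qed
  next
    fix z assume "z \<in> R \<union> flip m n ` R"
    then show "z \<in> {..m} \<times> {..n}"
      using bd[of z] by (cases z) (auto simp: flip_def split: prod.splits)
  qed
qed

lemma sum_rectangle_fold:
  fixes f :: "nat \<times> nat \<Rightarrow> real"
  assumes "coprime m n" "m > 0" "n > 0"
    and inv: "\<And>i j. i \<le> m \<Longrightarrow> j \<le> n \<Longrightarrow> f (m - i, n - j) = f (i, j)"
  shows "(\<Sum>z\<in>{..m} \<times> {..n}. f z) = 2 * (\<Sum>z\<in>insert (0, n) (tri m n). f z)"
proof -
  let ?R = "insert (0, n) (tri m n)"
  note R = rectangle_fold[OF assms(1-3)]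
  have fin: "finite ?R" using finite_tri by blast
  have "(\<Sum>z\<in>{..m} \<times> {..n}. f z) = (\<Sum>z\<in>?R. f z) + (\<Sum>z\<in>flip m n ` ?R. f z)"
    unfolding R(1) by (rule sum.union_disjoint) (use fin R(2) in auto)
  also have "(\<Sum>z\<in>flip m n ` ?R. f z) = (\<Sum>z\<in>?R. f (flip m n z))"
    using sum.reindex[OF R(3)] by simp
  also have "\<dots> = (\<Sum>z\<in>?R. f z)"
  proof (rule sum.cong[OF refl])
    fix z assume "z \<in> ?R"
    then have "z \<in> {..m} \<times> {..n}" using R(1) by blast
    then show "f (flip m n z) = f z" using inv by (auto simp: flip_def)
  qed
  finally show ?thesis by simp
qed

section \<open>Orthogonality on the even grid and its dual\<close>

lemma hw_flip: "i \<le> N \<Longrightarrow> hw N (N - i) = hw N i"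
  by (auto simp: hw_def)

lemma cos_flip:
  assumes "N > 0" "i \<le> N"
  shows "cos (real (N - i) * (real a * pi / real N)) = (-1) ^ a * cos (real i * (real a * pi / real N))"
proof -
  have "real (N - i) * (real a * pi / real N) = real a * pi - real i * (real a * pi / real N)"
    using assms by (simp add: field_simps of_nat_diff)
  then show ?thesis by (simp add: cos_diff)
qed

lemma Cheb_node:
  assumes "m > 0" "a \<le> m"
  shows "Cheb i (cos (real a * pi / real m)) = cos (real i * (real a * pi / real m))"
proof -
  have "real a * pi / real m \<le> pi" using assms by (simp add: field_simps)
  then show ?thesis by (simp add: Cheb_def arccos_cos)
qed

text \<open>The parity indicator is \<open>(1 + (-1) ^ (a + b)) / 2\<close>; by
  \<open>tcos_flip\<close> the sign amounts to flipping a frequency.\<close>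

lemma sum_even_grid:
  fixes f :: "nat \<times> nat \<Rightarrow> real"
  shows "(\<Sum>z\<in>even_grid m n. f z) = (\<Sum>a\<le>m. \<Sum>b\<le>n. f (a, b)) / 2 + (\<Sum>a\<le>m. \<Sum>b\<le>n. (-1) ^ a * (-1) ^ b * f (a, b)) / 2"
proof -
  have sgn: "(-1) ^ a * (-1) ^ b = (if even (a + b) then 1 else - 1 :: real)" for a b :: nat
    by (simp add: uminus_power_if)
  have "(\<Sum>z\<in>even_grid m n. f z) = (\<Sum>(a, b)\<in>{..m} \<times> {..n}. f (a, b) / 2 + (-1) ^ a * (-1) ^ b * f (a, b) / 2)"
    by (rule sum.mono_neutral_cong_left) (auto simp: even_grid_def sgn split: if_splits)
  also have "\<dots> = (\<Sum>a\<le>m. \<Sum>b\<le>n. f (a, b) / 2 + (-1) ^ a * (-1) ^ b * f (a, b) / 2)"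
    by (rule sum.cartesian_product[symmetric])
  also have "\<dots> = (\<Sum>a\<le>m. \<Sum>b\<le>n. f (a, b)) / 2 + (\<Sum>a\<le>m. \<Sum>b\<le>n. (-1) ^ a * (-1) ^ b * f (a, b)) / 2"
    by (simp only: sum.distrib sum_divide_distrib)
  finally show ?thesis .
qed

definition tcos :: "nat \<Rightarrow> nat \<Rightarrow> nat \<times> nat \<Rightarrow> nat \<times> nat \<Rightarrow> real" where
  "tcos m n = (\<lambda>(i, j) (a, b). cos (real i * (real a * pi / real m)) * cos (real j * (real b * pi / real n)))"

definition hw2 :: "nat \<Rightarrow> nat \<Rightarrow> nat \<times> nat \<Rightarrow> real" where
  "hw2 m n = (\<lambda>(i, j). hw m i * hw n j)"

lemma hw2_pos: "hw2 m n z > 0"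
  by (simp add: hw2_def hw_pos split: prod.splits)

lemma tcos_commute: "tcos m n z w = tcos m n w z"
  by (simp add: tcos_def mult.commute mult.left_commute split: prod.splits)

lemma tcos_rectangle_orthogonal:
  assumes mn: "m > 0" "n > 0" and z: "z \<in> {..m} \<times> {..n}" and w: "w \<in> {..m} \<times> {..n}"
  shows "(\<Sum>a\<le>m. \<Sum>b\<le>n. hw2 m n (a, b) * (tcos m n z (a, b) * tcos m n w (a, b)))
    = (if z = w then real m * real n / (4 * hw2 m n z) else 0)"
proof -
  obtain i j i' j' where zw: "z = (i, j)" "w = (i', j')" by (metis surj_pair)
  have b: "i \<le> m" "i' \<le> m" "j \<le> n" "j' \<le> n" using z w by (auto simp: zw)
  have "(\<Sum>a\<le>m. \<Sum>b\<le>n. hw2 m n (a, b) * (tcos m n z (a, b) * tcos m n w (a, b)))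
     = (\<Sum>a\<le>m. hw m a * (cos (real i * (real a * pi / real m)) * cos (real i' * (real a * pi / real m))))
     * (\<Sum>b\<le>n. hw n b * (cos (real j * (real b * pi / real n)) * cos (real j' * (real b * pi / real n))))"
    unfolding sum_product
    by (intro sum.cong[OF refl]) (simp add: hw2_def tcos_def zw mult.commute mult.left_commute)
  also have "\<dots> = (if z = w then real m * real n / (4 * hw2 m n z) else 0)"
    unfolding cos_grid_orthogonal[OF mn(1) b(1,2)] cos_grid_orthogonal[OF mn(2) b(3,4)]
    by (auto simp: zw hw2_def)
  finally show ?thesis .
qed

lemma tcos_flip:
  assumes "m > 0" "n > 0" "i \<le> m" "j \<le> n"
  shows "tcos m n (m - i, n - j) (a, b) = (-1) ^ a * (-1) ^ b * tcos m n (i, j) (a, b)"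
  unfolding tcos_def prod.case cos_flip[OF assms(1,3)] cos_flip[OF assms(2,4)] by (simp only: mult_ac)

text \<open>The sum is the average of the rectangle sums for \<open>z\<close> and for the flip of
  \<open>z\<close>, each against \<open>w\<close>. The latter vanishes because the flip leaves the
  index set, so half of the rectangle value remains.\<close>

lemma tcos_even_grid_orthogonal:
  assumes cop: "coprime m n" and mn: "m > 0" "n > 0"
    and z: "z \<in> insert (0, n) (tri m n)" and w: "w \<in> insert (0, n) (tri m n)"
  shows "(\<Sum>a\<in>even_grid m n. hw2 m n a * (tcos m n z a * tcos m n w a))
    = (if z = w then real m * real n / (8 * hw2 m n z) else 0)"
proof -
  note R = rectangle_fold[OF cop mn]
  obtain i j where ij: "z = (i, j)" by (cases z)
  have zr: "z \<in> {..m} \<times> {..n}" and wr: "w \<in> {..m} \<times> {..n}"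
    and fr: "flip m n z \<in> {..m} \<times> {..n}" and ne: "flip m n z \<noteq> w"
    using z w R by blast+
  have b: "i \<le> m" "j \<le> n" using zr by (auto simp: ij)
  have e: "(-1) ^ a * (-1) ^ b * (hw2 m n (a, b) * (tcos m n z (a, b) * tcos m n w (a, b)))
     = hw2 m n (a, b) * (tcos m n (flip m n z) (a, b) * tcos m n w (a, b))" for a b
    using tcos_flip[OF mn b] by (simp add: ij flip_def)
  show ?thesis
    unfolding sum_even_grid e
    using tcos_rectangle_orthogonal[OF mn zr wr] tcos_rectangle_orthogonal[OF mn fr wr] ne by simp
qed

text \<open>\<open>tcos\<close> is symmetric in frequency and node, so the rectangle relation may be
  read with the nodes fixed. For two nodes of even parity the signs from the flip cancel, and the
  triangle with its corner carries half of the rectangle sum.\<close>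

lemma tcos_tri_orthogonal:
  assumes cop: "coprime m n" and mn: "m > 0" "n > 0"
    and z: "z \<in> even_grid m n" and w: "w \<in> even_grid m n"
  shows "(\<Sum>k\<in>insert (0, n) (tri m n). hw2 m n k * (tcos m n k z * tcos m n k w))
    = (if z = w then real m * real n / (8 * hw2 m n z) else 0)"
proof -
  obtain a b a' b' where zw: "z = (a, b)" "w = (a', b')" by (metis surj_pair)
  have zr: "z \<in> {..m} \<times> {..n}" and wr: "w \<in> {..m} \<times> {..n}" and ev: "even (a + b)" "even (a' + b')"
    using z w by (auto simp: even_grid_def zw)
  have sgn: "(-1) ^ a * (-1) ^ b * ((-1) ^ a' * (-1) ^ b') = (1::real)"
    using ev by (simp flip: power_add)
  have inv: "hw2 m n (m - i, n - j) * (tcos m n (m - i, n - j) z * tcos m n (m - i, n - j) w)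
     = hw2 m n (i, j) * (tcos m n (i, j) z * tcos m n (i, j) w)" if ij: "i \<le> m" "j \<le> n" for i j
  proof -
    have "hw2 m n (m - i, n - j) * (tcos m n (m - i, n - j) z * tcos m n (m - i, n - j) w)
      = ((-1) ^ a * (-1) ^ b * ((-1) ^ a' * (-1) ^ b')) * (hw2 m n (i, j) * (tcos m n (i, j) z * tcos m n (i, j) w))"
      unfolding zw tcos_flip[OF mn ij] by (simp add: hw2_def hw_flip ij)
    then show ?thesis unfolding sgn by simp
  qed
  have "2 * (\<Sum>k\<in>insert (0, n) (tri m n). hw2 m n k * (tcos m n k z * tcos m n k w))
     = (\<Sum>k\<in>{..m} \<times> {..n}. hw2 m n k * (tcos m n k z * tcos m n k w))"
    using sum_rectangle_fold[OF cop mn, of "\<lambda>k. hw2 m n k * (tcos m n k z * tcos m n k w)"] inv by simp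
  also have "\<dots> = (\<Sum>i\<le>m. \<Sum>j\<le>n. hw2 m n (i, j) * (tcos m n z (i, j) * tcos m n w (i, j)))"
    unfolding tcos_commute[of m n _ z] tcos_commute[of m n _ w]
    by (simp add: sum.cartesian_product split_def)
  also have "\<dots> = (if z = w then real m * real n / (4 * hw2 m n z) else 0)"
    by (rule tcos_rectangle_orthogonal[OF mn zr wr])
  finally show ?thesis by (auto split: if_splits)
qed

text \<open>The explicit Lagrange polynomial: \<open>2 * hw2 m n z / (m * n)\<close> is the weight
  of the node, and \<open>4 * hw2 m n (i, j)\<close> collects the squared normalising factors of the
  Chebyshev polynomials. At \<open>(0, n)\<close> it is 1 instead of 2, which is the extra factor
  1/2 of the corner term.\<close>

definition lag :: "nat \<Rightarrow> nat \<Rightarrow> nat \<times> nat \<Rightarrow> real \<times> real \<Rightarrow> real" where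
  "lag m n z = (\<lambda>(x, y). \<Sum>(i, j)\<in>insert (0, n) (tri m n).
     8 * hw2 m n z / (real m * real n) * (hw2 m n (i, j) * tcos m n (i, j) z) * (Cheb i x * Cheb j y))"

lemma Cheb_product_node:
  assumes "m > 0" "n > 0" "w \<in> even_grid m n"
  shows "Cheb i (fst (node m n w)) * Cheb j (snd (node m n w)) = tcos m n (i, j) w"
  using assms by (auto simp: node_def even_grid_def tcos_def Cheb_node)

lemma lag_node:
  assumes cop: "coprime m n" and mn: "m > 0" "n > 0"
    and z: "z \<in> even_grid m n" and w: "w \<in> even_grid m n"
  shows "lag m n z (node m n w) = (if w = z then 1 else 0)"
proof -
  have "lag m n z (node m n w) = (\<Sum>k\<in>insert (0, n) (tri m n).
     8 * hw2 m n z / (real m * real n) * (hw2 m n k * (tcos m n k z * tcos m n k w)))"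
    unfolding lag_def split_def Cheb_product_node[OF mn w] by (simp add: mult.assoc)
  also have "\<dots> = (if w = z then 1 else 0)"
    unfolding sum_distrib_left[symmetric] tcos_tri_orthogonal[OF cop mn z w]
    using hw2_pos[of m n z] mn by auto
  finally show ?thesis .
qed

text \<open>Summation against \<open>tcos m n z\<close> over the weighted nodes isolates the
  coefficient at \<open>z\<close>. This gives uniqueness of interpolation.\<close>

lemma coeffs_vanish:
  assumes cop: "coprime m n" and mn: "m > 0" "n > 0"
    and vanish: "\<And>w. w \<in> even_grid m n \<Longrightarrow> (\<Sum>k\<in>insert (0, n) (tri m n). c k * tcos m n k w) = 0"
    and z: "z \<in> insert (0, n) (tri m n)"
  shows "c z = (0::real)"
proof -
  let ?R = "insert (0, n) (tri m n)"
  have fin: "finite ?R" using finite_tri by blast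
  have "0 = (\<Sum>w\<in>even_grid m n. hw2 m n w * tcos m n z w * (\<Sum>k\<in>?R. c k * tcos m n k w))"
    using vanish by simp
  also have "\<dots> = (\<Sum>k\<in>?R. \<Sum>w\<in>even_grid m n. c k * (hw2 m n w * (tcos m n z w * tcos m n k w)))"
    unfolding sum_distrib_left by (subst sum.swap) (simp only: mult_ac)
  also have "\<dots> = (\<Sum>k\<in>?R. if k = z then c z * (real m * real n / (8 * hw2 m n z)) else 0)"
    unfolding sum_distrib_left[symmetric]
    by (rule sum.cong[OF refl]) (auto simp: tcos_even_grid_orthogonal[OF cop mn z])
  also have "\<dots> = c z * (real m * real n / (8 * hw2 m n z))"
    using fin z by (simp only: sum.delta if_True)
  finally show ?thesis using mn hw2_pos[of m n z] by auto
qed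

text \<open>\<open>lag_node\<close> gives existence. Uniqueness compares coefficients, so the two
  functions agree on the whole plane, as the definite description demands.\<close>

lemma lagrange_eq_lag:
  assumes n: "n > 0" and cop: "coprime n (n + p)" and z: "z \<in> even_grid (n + p) n"
  shows "lagrange n p (node (n + p) n z) = lag (n + p) n z"
proof -
  define m where "m = n + p"
  have mn: "m > 0" "n > 0" using n by (auto simp: m_def)
  have cop': "coprime m n" using cop by (simp add: m_def coprime_commute)
  note LD = LD_eq_node_image[OF n cop, folded m_def]
  note G = GamL_eq[OF n, of p, folded m_def]
  have z: "z \<in> even_grid m n" using z by (simp add: m_def)
  let ?R = "insert (0, n) (tri m n)"
  have isl: "is_lagrange n p (node m n z) (lag m n z)"
    unfolding is_lagrange_def LD PiL_def G
  proof
    show "lag m n z \<in> {f. \<exists>c. f = (\<lambda>(x, y). \<Sum>(i, j)\<in>?R. c (i, j) * (Cheb i x * Cheb j y))}"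
      unfolding lag_def
      by (rule CollectI, rule exI[of _ "\<lambda>k. 8 * hw2 m n z / (real m * real n) * (hw2 m n k * tcos m n k z)"]) (rule refl)
    show "\<forall>B\<in>node m n ` even_grid m n. lag m n z B = (if B = node m n z then 1 else 0)"
      using lag_node[OF cop' mn z] inj_on_node[OF mn] z by (auto dest: inj_onD)
  qed
  have uniq: "f = lag m n z" if f: "is_lagrange n p (node m n z) f" for f
  proof -
    obtain c where c: "f = (\<lambda>(x, y). \<Sum>(i, j)\<in>?R. c (i, j) * (Cheb i x * Cheb j y))"
      using f unfolding is_lagrange_def PiL_def G by blast
    obtain d where d: "lag m n z = (\<lambda>(x, y). \<Sum>(i, j)\<in>?R. d (i, j) * (Cheb i x * Cheb j y))"
      using isl unfolding is_lagrange_def PiL_def G by blast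
    have ev: "g (node m n w) = (\<Sum>k\<in>?R. e k * tcos m n k w)"
      if "g = (\<lambda>(x, y). \<Sum>(i, j)\<in>?R. e (i, j) * (Cheb i x * Cheb j y))" "w \<in> even_grid m n" for g e w
      unfolding that(1) split_def Cheb_product_node[OF mn that(2)] by simp
    have "(\<Sum>k\<in>?R. (c k - d k) * tcos m n k w) = 0" if w: "w \<in> even_grid m n" for w
    proof -
      have "f (node m n w) = lag m n z (node m n w)"
        using f isl w unfolding is_lagrange_def LD by auto
      then show ?thesis unfolding ev[OF c w] ev[OF d w] by (simp only: left_diff_distrib sum_subtractf)
    qed
    then have "c k = d k" if "k \<in> ?R" for k
      using coeffs_vanish[OF cop' mn, of "\<lambda>k. c k - d k", OF _ that] by simp
    then have "(\<Sum>(i, j)\<in>?R. c (i, j) * (Cheb i x * Cheb j y)) = (\<Sum>(i, j)\<in>?R. d (i, j) * (Cheb i x * Cheb j y))" for x y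
      by (intro sum.cong[OF refl]) (simp add: split_def)
    then show ?thesis unfolding c d by presburger
  qed
  show ?thesis unfolding lagrange_def m_def[symmetric]
    using isl uniq by (rule the_equality)
qed

lemma sum_LD:
  assumes n: "n > 0" and cop: "coprime n (n + p)"
  shows "(\<Sum>A\<in>LD n p. \<bar>lagrange n p A z\<bar>) = (\<Sum>k\<in>even_grid (n + p) n. \<bar>lag (n + p) n k z\<bar>)"
proof -
  have "inj_on (node (n + p) n) (even_grid (n + p) n)" using inj_on_node n by simp
  then show ?thesis unfolding LD_eq_node_image[OF assms]
    by (simp add: sum.reindex lagrange_eq_lag[OF assms] cong: sum.cong)
qed

section \<open>Sums of reciprocal sines over equidistant points\<close>

text \<open>Sine is concave on \<open>{0..pi/2}\<close> and hence lies above its chord.\<close>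

lemma jordan_sine:
  assumes "0 \<le> x" "x \<le> pi / 2"
  shows "2 * x / pi \<le> sin x"
proof -
  have "convex_on {0..pi/2} (\<lambda>x. - sin x)"
  proof (rule f''_ge0_imp_convex[where f' = "\<lambda>x. - cos x" and f'' = sin])
    show "convex {0..pi/2::real}" by simp
    show "((\<lambda>x. - sin x) has_real_derivative - cos x) (at x)" for x
      by (auto intro!: derivative_eq_intros)
    show "((\<lambda>x. - cos x) has_real_derivative sin x) (at x)" for x
      by (auto intro!: derivative_eq_intros)
    show "0 \<le> sin x" if "x \<in> {0..pi/2}" for x
      using that by (intro sin_ge_zero) auto
  qed
  then have "- sin ((1 - 2*x/pi) *\<^sub>R 0 + (2*x/pi) *\<^sub>R (pi/2)) \<le> (1 - 2*x/pi) * (- sin 0) + (2*x/pi) * (- sin (pi/2))"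
    by (rule convex_onD) (use assms in \<open>auto simp: field_simps\<close>)
  then show ?thesis by simp
qed

text \<open>Jordan's inequality from the nearer end of \<open>{0..pi}\<close>; adding both
  reciprocals avoids a case distinction later.\<close>

lemma inverse_sine_le:
  assumes "0 < x" "x < pi"
  shows "1 / sin x \<le> pi / 2 * (1 / x + 1 / (pi - x))"
proof (cases "x \<le> pi / 2")
  case True
  have "1 / sin x \<le> 1 / (2 * x / pi)"
    using jordan_sine[of x] assms True by (intro divide_left_mono) (auto simp: sin_gt_zero)
  also have "\<dots> = pi / 2 * (1 / x)" using assms by (simp add: field_simps)
  also have "\<dots> \<le> pi / 2 * (1 / x + 1 / (pi - x))" using assms by (intro mult_left_mono) auto
  finally show ?thesis .
next
  case False
  have "2 * (pi - x) / pi \<le> sin x" using jordan_sine[of "pi - x"] assms False by simp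
  then have "1 / sin x \<le> 1 / (2 * (pi - x) / pi)"
    using assms by (intro divide_left_mono) (auto simp: sin_gt_zero)
  also have "\<dots> = pi / 2 * (1 / (pi - x))" using assms by (simp add: field_simps)
  also have "\<dots> \<le> pi / 2 * (1 / x + 1 / (pi - x))" using assms by (intro mult_left_mono) auto
  finally show ?thesis .
qed

lemma sum_inverse_le_ln:
  assumes "N > 0"
  shows "(\<Sum>a=1..N. 1 / real a) \<le> 1 + ln (real N)"
proof -
  obtain k where k: "N = Suc k" using assms gr0_implies_Suc by blast
  have "harm (Suc k) - ln (Suc k) \<le> harm (Suc 0) - ln (Suc 0)"
    using decseq_harm_diff_ln by (rule decseqD) simp
  then show ?thesis by (simp add: k harm_def inverse_eq_divide)
qed

lemma sum_periodic_shift: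
  fixes F :: "int \<Rightarrow> real"
  assumes per: "\<And>a. F (a + int N) = F a"
  shows "(\<Sum>a<N. F (int a + q)) = (\<Sum>a<N. F (int a))"
proof -
  have step: "(\<Sum>a<N. F (int a + (q + 1))) = (\<Sum>a<N. F (int a + q))" for q
  proof -
    have "(\<Sum>a<N. F (int a + (q + 1))) = (\<Sum>a<Suc N. F (int a + q)) - F q"
      by (simp only: sum.lessThan_Suc_shift) (simp add: algebra_simps)
    also have "\<dots> = (\<Sum>a<N. F (int a + q))"
      using per[of q] by (simp add: add.commute)
    finally show ?thesis .
  qed
  show ?thesis
  proof (induction q rule: int_induct[where k = 0])
    case (step2 i)
    then show ?case using step[of "i - 1"] by simp
  qed (simp_all only: step add_0_right)
qed

text \<open>After an integer shift the sample points start in \<open>[0, pi / N)\<close>. Only the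
  first and the last can come arbitrarily close to a zero of the sine, and these are bounded by
  \<open>M\<close>; the rest is dominated by harmonic sums from both ends. Only upper bounds on
  \<open>F\<close> enter, since \<open>sum_dirk_grid_le\<close> relies on this for a function that
  may be negative.\<close>

lemma sum_reciprocal_sine_bound:
  fixes F :: "int \<Rightarrow> real"
  assumes N: "N > 0" and per: "\<And>a. F (a + int N) = F a"
    and M: "M \<ge> 0" "\<And>a. F a \<le> M"
    and sine: "\<And>a. F a * \<bar>sin (u + pi * of_int a / real N)\<bar> \<le> 1"
  shows "(\<Sum>a<N. F (int a)) \<le> 2 * M + real N * (1 + ln (real N))"
proof -
  define q where "q = - \<lfloor>u * real N / pi\<rfloor>"
  define u' where "u' = u + pi * of_int q / real N"
  have qb: "of_int (- q) \<le> u * real N / pi" "u * real N / pi < of_int (- q) + 1"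
    unfolding q_def by simp_all
  have u': "0 \<le> u'" "u' < pi / real N"
  proof -
    have e: "u' = (u * real N / pi - of_int (- q)) * (pi / real N)"
      using N by (simp add: u'_def field_simps)
    show "0 \<le> u'" unfolding e using qb N by (intro mult_nonneg_nonneg) auto
    have "u' < 1 * (pi / real N)" unfolding e using qb N by (intro mult_strict_right_mono) auto
    then show "u' < pi / real N" by simp
  qed
  have ln0: "0 \<le> ln (real N)" using N by simp
  \<comment> \<open>The sample point is at distance at least \<open>pi * a / N\<close> from 0 and
    \<open>pi * (N - 1 - a) / N\<close> from \<open>pi\<close>; both are positive for these
    \<open>a\<close>.\<close>
  have inner: "F (int a + q) \<le> real N / 2 * (1 / real a + 1 / real (N - 1 - a))"
    if a: "0 < a" "a < N - 1" for a
  proof -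
    define x where "x = u' + pi * real a / real N"
    have x: "pi * real a / real N \<le> x" "pi * real (N - 1 - a) / real N \<le> pi - x"
    proof -
      show "pi * real a / real N \<le> x" using u' by (simp add: x_def)
      have "pi * real (N - 1 - a) / real N = pi - pi / real N - pi * real a / real N"
        using a N by (simp add: field_simps of_nat_diff)
      then show "pi * real (N - 1 - a) / real N \<le> pi - x" using u' by (simp add: x_def)
    qed
    have pos: "0 < pi * real a / real N" "0 < pi * real (N - 1 - a) / real N" using a N by auto
    have x0: "0 < x" "x < pi"
      using less_le_trans[OF pos(1) x(1)] less_le_trans[OF pos(2) x(2)] by simp_all
    then have s: "sin x > 0" by (rule sin_gt_zero)
    have "u + pi * of_int (int a + q) / real N = x"
      by (simp add: x_def u'_def algebra_simps add_divide_distrib)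
    then have "F (int a + q) * sin x \<le> 1" using sine[of "int a + q"] s by simp
    then have "F (int a + q) \<le> 1 / sin x" using s by (simp add: field_simps)
    also have "\<dots> \<le> pi / 2 * (1 / x + 1 / (pi - x))" by (rule inverse_sine_le[OF x0])
    also have "\<dots> \<le> pi / 2 * (1 / (pi * real a / real N) + 1 / (pi * real (N - 1 - a) / real N))"
      by (intro mult_left_mono add_mono frac_le[OF _ _ pos(1) x(1)] frac_le[OF _ _ pos(2) x(2)]) simp_all
    also have "\<dots> = real N / 2 * (1 / real a + 1 / real (N - 1 - a))"
    proof -
      have "pi / 2 * (1 / (pi * y / real N)) = real N / 2 * (1 / y)" for y
        by (cases "y = 0") (simp_all add: field_simps)
      then show ?thesis by (simp only: distrib_left)
    qed
    finally show ?thesis .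
  qed
  have "(\<Sum>a<N. F (int a)) = (\<Sum>a<N. F (int a + q))"
    using sum_periodic_shift[of F N q] per by simp
  also have "\<dots> \<le> (\<Sum>a\<in>{0, N - 1}. M) + (\<Sum>a=1..<N-1. F (int a + q))"
  proof -
    have "{..<N} = {0, N - 1} \<union> {1..<N-1}" using N by auto
    then have "(\<Sum>a<N. F (int a + q)) = (\<Sum>a\<in>{0, N - 1}. F (int a + q)) + (\<Sum>a=1..<N-1. F (int a + q))"
      by (simp only:) (subst sum.union_disjoint, auto)
    also have "(\<Sum>a\<in>{0, N - 1}. F (int a + q)) \<le> (\<Sum>a\<in>{0, N - 1}. M)"
      by (intro sum_mono M(2))
    finally show ?thesis by simp
  qed
  \<comment> \<open>For \<open>N = 1\<close> the two exceptional indices coincide.\<close>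
  also have "(\<Sum>a\<in>{0, N - 1}. M) \<le> 2 * M"
    using M(1) by (cases "N - 1 = 0") auto
  also have "(\<Sum>a=1..<N-1. F (int a + q)) \<le> real N * (1 + ln (real N))"
  proof -
    have "(\<Sum>a=1..<N-1. F (int a + q)) \<le> (\<Sum>a=1..<N-1. real N / 2 * (1 / real a + 1 / real (N - 1 - a)))"
      by (intro sum_mono inner) auto
    also have "\<dots> = real N / 2 * ((\<Sum>a=1..<N-1. 1 / real a) + (\<Sum>a=1..<N-1. 1 / real (N - 1 - a)))"
      by (simp only: sum.distrib sum_distrib_left distrib_left)
    also have "(\<Sum>a=1..<N-1. 1 / real (N - 1 - a)) = (\<Sum>a=1..<N-1. 1 / real a)"
      by (rule sum.reindex_bij_witness[of _ "\<lambda>a. N - 1 - a" "\<lambda>a. N - 1 - a"]) auto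
    also have "real N / 2 * ((\<Sum>a=1..<N-1. 1 / real a) + (\<Sum>a=1..<N-1. 1 / real a)) = real N * (\<Sum>a=1..<N-1. 1 / real a)"
      by simp
    also have "(\<Sum>a=1..<N-1. 1 / real a) \<le> (\<Sum>a=1..N. 1 / real a)"
      by (intro sum_mono2) auto
    also have "\<dots> \<le> 1 + ln (real N)" by (rule sum_inverse_le_ln[OF N])
    finally show ?thesis using N by simp
  qed
  finally show ?thesis by simp
qed

section \<open>Exponential sums in one variable\<close>

definition edirk :: "nat \<Rightarrow> real \<Rightarrow> real" where
  "edirk n x = cmod (\<Sum>j<n. cis (real j * x))"

lemma edirk_le: "edirk n x \<le> real n"
proof -
  have "edirk n x \<le> (\<Sum>j<n. cmod (cis (real j * x)))" unfolding edirk_def by (rule norm_sum)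
  then show ?thesis by simp
qed

lemma edirk_nonneg: "0 \<le> edirk n x"
  by (simp add: edirk_def)

lemma norm_cis_minus_1: "cmod (cis x - 1) = 2 * \<bar>sin (x / 2)\<bar>"
proof -
  have "cis x - 1 = cis (x/2) * (2 * \<i> * complex_of_real (sin (x/2)))"
  proof -
    have "cos x = cos (2 * (x/2))" "sin x = sin (2 * (x/2))" by simp_all
    then have "cos x = 1 - 2 * (sin (x/2))\<^sup>2" "sin x = 2 * sin (x/2) * cos (x/2)"
      by (simp_all only: cos_double_sin sin_double)
    then show ?thesis by (simp add: complex_eq_iff power2_eq_square)
  qed
  then show ?thesis by (simp add: norm_mult)
qed

text \<open>Closed form of the geometric sum, with both chords measured by
  \<open>norm_cis_minus_1\<close>.\<close>

lemma edirk_sine: "edirk n x * \<bar>sin (x/2)\<bar> = \<bar>sin (real n * x / 2)\<bar>"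
proof -
  have "(cis x - 1) * (\<Sum>j<n. cis (real j * x)) = cis (real n * x) - 1"
    using power_diff_1_eq[of "cis x" n] unfolding Complex.DeMoivre by simp
  then have "cmod (cis x - 1) * edirk n x = cmod (cis (real n * x) - 1)"
    unfolding edirk_def by (simp flip: norm_mult)
  then show ?thesis unfolding norm_cis_minus_1 by (simp add: mult.commute)
qed

lemma edirk_cong: "cis x = cis y \<Longrightarrow> edirk n x = edirk n y"
  unfolding edirk_def Complex.DeMoivre[symmetric] by simp

lemma edirk_minus: "edirk n (- x) = edirk n x"
proof -
  have "(\<Sum>j<n. cis (real j * (- x))) = cnj (\<Sum>j<n. cis (real j * x))"
    by (simp add: cis_cnj)
  then show ?thesis unfolding edirk_def by (simp only: complex_mod_cnj)
qed

section \<open>The Dirichlet kernel of the triangle\<close>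

lemma cos_nat_periodic: "cos (real i * (x + 2 * pi)) = cos (real i * x)"
proof -
  have "real i * (x + 2 * pi) = real i * x + 2 * real i * pi" by (simp add: algebra_simps)
  then show ?thesis by (simp add: cos_add cos_2npi sin_2npi)
qed

text \<open>Sampling over a full period \<open>2 * pi\<close>: half the argument runs through one
  period of the absolute sine in \<open>2 * N\<close> steps, so
  \<open>sum_reciprocal_sine_bound\<close> applies with \<open>2 * N\<close>.\<close>

lemma grid_sum_le:
  fixes f :: "real \<Rightarrow> real"
  assumes N: "N > 0" and M: "M \<ge> 0"
    and per: "\<And>x. f (x + 2 * pi) = f x" and le: "\<And>x. f x \<le> M" and sine: "\<And>x. f x * \<bar>sin (x / 2)\<bar> \<le> 1"
  shows "(\<Sum>b<2*N. f (x + pi * real b / real N)) \<le> 2 * M + 2 * real N * (2 + ln (real N))"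
proof -
  define F where "F b = f (x + pi * of_int b / real N)" for b :: int
  have "(\<Sum>b<2*N. F (int b)) \<le> 2 * M + real (2*N) * (1 + ln (real (2*N)))"
  proof (rule sum_reciprocal_sine_bound)
    show "0 < 2 * N" using N by simp
    show "F (a + int (2 * N)) = F a" for a
    proof -
      have "x + pi * of_int (a + int (2 * N)) / real N = (x + pi * of_int a / real N) + 2 * pi"
        using N by (simp add: field_simps)
      then show ?thesis unfolding F_def by (simp only: per)
    qed
    show "F a * \<bar>sin (x / 2 + pi * of_int a / real (2*N))\<bar> \<le> 1" for a
    proof -
      have "x / 2 + pi * of_int a / real (2*N) = (x + pi * of_int a / real N) / 2"
        using N by (simp add: field_simps)
      then show ?thesis unfolding F_def using sine[of "x + pi * of_int a / real N"] by (simp only:)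
    qed
  qed (use M le in \<open>simp_all add: F_def\<close>)
  also have "ln (real (2*N)) \<le> 1 + ln (real N)"
    using N ln_add_one_self_le_self[of 1] by (simp add: ln_mult)
  finally show ?thesis using N by (simp add: F_def algebra_simps)
qed

text \<open>For positive \<open>K\<close>, \<open>2 * hdirk K\<close> is the classical Dirichlet
  kernel of order \<open>K - 1\<close>.\<close>

definition hdirk :: "nat \<Rightarrow> real \<Rightarrow> real" where
  "hdirk K x = (\<Sum>i<K. h0 i * cos (real i * x))"

lemma hdirk_sine: "K > 0 \<Longrightarrow> 2 * sin (x/2) * hdirk K x = sin ((real K - 1/2) * x)"
  unfolding hdirk_def by (rule half_dirichlet)

lemma h0_bounds: "0 \<le> h0 i" "h0 i \<le> 1"
  by (auto simp: h0_def)

lemma abs_hdirk_le: "\<bar>hdirk K x\<bar> \<le> real K"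
proof -
  have "\<bar>hdirk K x\<bar> \<le> (\<Sum>i<K. \<bar>h0 i * cos (real i * x)\<bar>)"
    unfolding hdirk_def by (rule sum_abs)
  also have "\<dots> \<le> (\<Sum>i<K. 1)"
    using h0_bounds by (intro sum_mono) (simp add: abs_mult mult_le_one)
  finally show ?thesis by simp
qed

lemma abs_hdirk_sine_le: "\<bar>hdirk K x\<bar> * \<bar>sin (x/2)\<bar> \<le> 1"
proof (cases "K > 0")
  case True
  have "\<bar>2 * sin (x/2) * hdirk K x\<bar> \<le> 1" unfolding hdirk_sine[OF True] by simp
  then have "2 * (\<bar>hdirk K x\<bar> * \<bar>sin (x/2)\<bar>) \<le> 1" by (simp add: abs_mult mult_ac)
  moreover have "0 \<le> \<bar>hdirk K x\<bar> * \<bar>sin (x/2)\<bar>" by simp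
  ultimately show ?thesis by linarith
qed (simp add: hdirk_def)

definition dirk :: "nat \<Rightarrow> nat \<Rightarrow> real \<Rightarrow> real \<Rightarrow> real" where
  "dirk m n s t = (\<Sum>(i, j)\<in>tri m n. h0 i * h0 j * (cos (real i * s) * cos (real j * t)))"

text \<open>The ceiling of \<open>m * (n - j) / n\<close>, which is the number of \<open>i\<close>
  with \<open>(i, j)\<close> strictly below the hypotenuse.\<close>

definition rowlen :: "nat \<Rightarrow> nat \<Rightarrow> nat \<Rightarrow> nat" where
  "rowlen m n j = (m * (n - j) + (n - 1)) div n"

lemma less_rowlen_iff:
  assumes "n > 0"
  shows "i < rowlen m n j \<longleftrightarrow> i * n < m * (n - j)"
proof -
  have "i < rowlen m n j \<longleftrightarrow> Suc i * n \<le> m * (n - j) + (n - 1)"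
    unfolding rowlen_def Suc_le_eq[symmetric] using assms by (rule less_eq_div_iff_mult_less_eq)
  also have "\<dots> \<longleftrightarrow> i * n < m * (n - j)" using assms by auto
  finally show ?thesis .
qed

lemma tri_iff_rowlen:
  assumes n: "n > 0"
  shows "(i, j) \<in> tri m n \<longleftrightarrow> j < n \<and> i < rowlen m n j"
proof (cases "j < n")
  case True
  then obtain l where "n = j + l" using less_imp_add_positive by blast
  then have "i * n + j * m < m * n \<longleftrightarrow> i * n < m * (n - j)" by (simp add: algebra_simps)
  then show ?thesis unfolding less_rowlen_iff[OF n] using True by (simp add: tri_def)
qed (use tri_bounds in blast)

lemma rowlen_bounds:
  assumes "m > 0" "j < n"
  obtains r where "rowlen m n j * n = m * (n - j) + r" "r < n"
proof
  define K where "K = rowlen m n j"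
  have n: "n > 0" using assms by simp
  have "\<not> K * n < m * (n - j)" using less_rowlen_iff[OF n, of K m j] by (simp add: K_def)
  then show "rowlen m n j * n = m * (n - j) + (K * n - m * (n - j))" by (simp add: K_def)
  have "K * n \<le> m * (n - j) + (n - 1)" unfolding K_def rowlen_def by simp
  then show "K * n - m * (n - j) < n" using n by linarith
qed

lemma rowlen_pos:
  assumes "m > 0" "j < n"
  shows "rowlen m n j > 0"
  using less_rowlen_iff[of n 0 m j] assms by simp

lemma rowlen_le:
  assumes "n > 0"
  shows "rowlen m n j \<le> m"
proof -
  have "m * (n - j) \<le> m * n" by simp
  then show ?thesis using less_rowlen_iff[OF assms, of m m j] by linarith
qed

lemma dirk_rows:
  assumes n: "n > 0"
  shows "dirk m n s t = (\<Sum>j<n. h0 j * cos (real j * t) * hdirk (rowlen m n j) s)"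
proof -
  have "(\<Sum>j<n. h0 j * cos (real j * t) * hdirk (rowlen m n j) s)
     = (\<Sum>(j, i)\<in>Sigma {..<n} (\<lambda>j. {..<rowlen m n j}). h0 i * h0 j * (cos (real i * s) * cos (real j * t)))"
    unfolding hdirk_def sum_distrib_left
    by (subst sum.Sigma) (auto intro!: sum.cong)
  also have "\<dots> = dirk m n s t"
    unfolding dirk_def
    by (rule sum.reindex_bij_witness[of _ "\<lambda>(i, j). (j, i)" "\<lambda>(j, i). (i, j)"])
      (use n in \<open>auto simp: tri_iff_rowlen\<close>)
  finally show ?thesis by simp
qed

lemma dirk_commute: "dirk m n s t = dirk n m t s"
  unfolding dirk_def
  by (rule sum.reindex_bij_witness[of _ "\<lambda>(i, j). (j, i)" "\<lambda>(j, i). (i, j)"])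
    (auto simp: tri_def algebra_simps)

lemma dirk_periodic: "dirk m n (s + 2 * pi) t = dirk m n s t"
  unfolding dirk_def cos_nat_periodic ..

lemma sum_roots_of_unity:
  assumes n: "n > 0" and d: "\<bar>d\<bar> < int n"
  shows "(\<Sum>k<n. cis (real k * (2 * pi * of_int d / real n))) = (if d = 0 then of_nat n else 0)"
proof (cases "d = 0")
  case False
  define x where "x = 2 * pi * of_int d / real n"
  have "sin (real n * x / 2) = 0"
    using n by (simp add: x_def)
  moreover have "sin (x / 2) \<noteq> 0"
  proof -
    have h: "0 < sin (pi * of_int e / real n)" if "0 < e" "e < int n" for e :: int
    proof (rule sin_gt_zero)
      have "real_of_int e < real n" using that by linarith
      then show "pi * of_int e / real n < pi" using n by (simp add: field_simps)
    qed (use that n in simp)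
    have "x / 2 = pi * of_int d / real n" "- (x / 2) = pi * of_int (- d) / real n" by (simp_all add: x_def)
    then have "0 < sin (x / 2) \<or> 0 < sin (- (x / 2))"
      using h[of d] h[of "- d"] d False by (metis abs_less_iff linorder_cases neg_0_less_iff_less)
    then show ?thesis by auto
  qed
  ultimately have "edirk n x = 0" using edirk_sine[of n x] by simp
  then show ?thesis using False by (simp add: edirk_def x_def)
qed simp

text \<open>Discrete Fourier inversion on the residues \<open>r < n\<close>, for arbitrary real
  \<open>s\<close>. The coefficients are geometric sums, so their moduli are values of
  \<open>edirk n\<close> divided by \<open>n\<close>.\<close>

lemma cis_finite_fourier:
  assumes r: "r < n"
  shows "cis (s * real r / real n) = (\<Sum>k<n. (\<Sum>q<n. cis (real q * ((s + 2 * pi * real k) / real n))) / of_nat n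
      * cis (- (2 * pi * real k * real r / real n)))"
proof -
  have n: "n > 0" using r by simp
  have "(\<Sum>k<n. (\<Sum>q<n. cis (real q * ((s + 2 * pi * real k) / real n))) / of_nat n
      * cis (- (2 * pi * real k * real r / real n)))
    = (\<Sum>k<n. \<Sum>q<n. cis (s * real q / real n) * cis (real k * (2 * pi * of_int (int q - int r) / real n)) / of_nat n)"
    unfolding sum_divide_distrib sum_distrib_right
    by (intro sum.cong refl) (simp add: cis_mult add_divide_distrib diff_divide_distrib algebra_simps)
  also have "\<dots> = (\<Sum>q<n. cis (s * real q / real n) * (\<Sum>k<n. cis (real k * (2 * pi * of_int (int q - int r) / real n))) / of_nat n)"
    by (subst sum.swap) (simp only: sum_distrib_left sum_divide_distrib)
  also have "\<dots> = (\<Sum>q<n. if q = r then cis (s * real r / real n) else 0)"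
  proof (rule sum.cong[OF refl])
    fix q assume "q \<in> {..<n}"
    then have "\<bar>int q - int r\<bar> < int n" using r by auto
    from sum_roots_of_unity[OF n this]
    show "cis (s * real q / real n) * (\<Sum>k<n. cis (real k * (2 * pi * of_int (int q - int r) / real n))) / of_nat n
      = (if q = r then cis (s * real r / real n) else 0)"
      using n by simp
  qed
  also have "\<dots> = cis (s * real r / real n)" using r by simp
  finally show ?thesis by simp
qed

text \<open>The row length \<open>K\<close> satisfies \<open>K n = m (n - j) + r\<close> with a remainder \<open>r\<close> depending erratically on \<open>j\<close>.
  Expanding \<open>r \<mapsto> cis (s r / n)\<close> in characters modulo \<open>n\<close> leaves only linear phases in \<open>j\<close>,
  because \<open>r\<close> is congruent to \<open>- m (n - j)\<close>.\<close>

lemma cis_rowlen: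
  assumes m: "m > 0" and j: "j < n"
  shows "cis (real (rowlen m n j) * s) = (\<Sum>k<n. (\<Sum>q<n. cis (real q * ((s + 2 * pi * real k) / real n))) / of_nat n
      * cis (real (n - j) * (real m * (s + 2 * pi * real k) / real n)))"
proof -
  obtain r where r: "rowlen m n j * n = m * (n - j) + r" "r < n" using rowlen_bounds[OF assms] .
  define K where "K = rowlen m n j"
  define l where "l = n - j"
  have n: "n > 0" using j by simp
  have "real K * real n = real m * real l + real r"
    using r(1) unfolding K_def l_def of_nat_mult[symmetric] of_nat_add[symmetric] by simp
  then have Kr: "real K = real m * real l / real n + real r / real n" using n by (simp add: field_simps)
  have "real K * s = real l * (real m * s / real n) + s * real r / real n"
    unfolding Kr by (simp add: algebra_simps)
  then have "cis (real K * s) = cis (real l * (real m * s / real n)) * cis (s * real r / real n)"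
    by (simp add: cis_mult)
  also have "\<dots> = (\<Sum>k<n. (\<Sum>q<n. cis (real q * ((s + 2 * pi * real k) / real n))) / of_nat n
      * (cis (real l * (real m * s / real n)) * cis (- (2 * pi * real k * real r / real n))))"
    unfolding cis_finite_fourier[OF r(2)] sum_distrib_left by (simp only: mult_ac)
  also have "\<dots> = (\<Sum>k<n. (\<Sum>q<n. cis (real q * ((s + 2 * pi * real k) / real n))) / of_nat n
      * cis (real l * (real m * (s + 2 * pi * real k) / real n)))"
  proof -
    \<comment> \<open>Because \<open>r = K * n - m * l\<close>, the phase of the \<open>k\<close>-th
      character differs from one linear in \<open>l\<close> by \<open>k * K\<close> full
      turns.\<close>
    have "cis (real l * (real m * s / real n)) * cis (- (2 * pi * real k * real r / real n))
        = cis (real l * (real m * (s + 2 * pi * real k) / real n))" for k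
    proof -
      have rr: "real r = real K * real n - real m * real l" using Kr n by (simp add: field_simps)
      have "real l * (real m * s / real n) + - (2 * pi * real k * real r / real n)
         + 2 * real (k * K) * pi = real l * (real m * (s + 2 * pi * real k) / real n)"
        unfolding rr using n by (simp add: field_simps)
      then have "cis (real l * (real m * (s + 2 * pi * real k) / real n))
        = cis (real l * (real m * s / real n)) * cis (- (2 * pi * real k * real r / real n)) * cis (2 * real (k * K) * pi)"
        by (simp only: cis_mult)
      moreover have "cis (2 * real (k * K) * pi) = 1"
        by (simp only: complex_eq_iff cis.sel cos_2npi sin_2npi one_complex.sel)
      ultimately show ?thesis by simp
    qed
    then show ?thesis by simp
  qed
  finally show ?thesis by (simp only: K_def l_def)
qed

section \<open>Upper bound\<close>

text \<open>The cosine splits into two exponentials, giving geometric sums at \<open>t - w\<close>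
  and \<open>t + w\<close>; the summand 1/2 accounts for the halved term
  \<open>j = 0\<close>.\<close>

lemma norm_twisted_row_le:
  assumes n: "n > 0"
  shows "cmod (\<Sum>j<n. complex_of_real (h0 j * cos (real j * t)) * cis (real (n - j) * w))
    \<le> 1/2 + (edirk n (t - w) + edirk n (t + w)) / 2"
proof -
  define f where "f j = (cis (real j * (t - w)) + cis (real j * (- (t + w)))) / 2" for j
  have term_eq: "complex_of_real (h0 j * cos (real j * t)) * cis (real (n - j) * w) = cis (real n * w) * (h0 j * f j)"
    if "j < n" for j
  proof -
    have "real (n - j) * w = real n * w + - (real j * w)"
      using that by (simp add: of_nat_diff algebra_simps)
    then have c: "cis (real (n - j) * w) = cis (real n * w) * cis (- (real j * w))" by (simp add: cis_mult)
    have "complex_of_real (cos (real j * t)) = (cis (real j * t) + cis (- (real j * t))) / 2"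
      by (simp add: complex_eq_iff)
    moreover have "cis (real j * t) * cis (- (real j * w)) = cis (real j * (t - w))"
      "cis (- (real j * t)) * cis (- (real j * w)) = cis (real j * (- (t + w)))"
      by (simp_all add: cis_mult algebra_simps)
    ultimately have "complex_of_real (cos (real j * t)) * cis (- (real j * w)) = f j"
      unfolding f_def by (simp add: add_divide_distrib distrib_right)
    then show ?thesis unfolding c by (simp add: mult.assoc mult.left_commute)
  qed
  have "(\<Sum>j<n. complex_of_real (h0 j * cos (real j * t)) * cis (real (n - j) * w))
     = cis (real n * w) * (\<Sum>j<n. h0 j * f j)"
    unfolding sum_distrib_left by (rule sum.cong[OF refl], rule term_eq) simp
  also have "(\<Sum>j<n. h0 j * f j) = (\<Sum>j<n. f j) - 1 / 2"
  proof -
    obtain M where N: "n = Suc M" using n gr0_implies_Suc by blast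
    show ?thesis unfolding N sum.lessThan_Suc_shift by (simp add: h0_def f_def)
  qed
  finally have "cmod (\<Sum>j<n. complex_of_real (h0 j * cos (real j * t)) * cis (real (n - j) * w))
     = cmod ((\<Sum>j<n. f j) - 1 / 2)" by (simp add: norm_mult)
  also have "\<dots> \<le> cmod (\<Sum>j<n. f j) + 1/2"
    using norm_triangle_ineq4[of "\<Sum>j<n. f j" "1/2"] by simp
  also have "(\<Sum>j<n. f j) = ((\<Sum>j<n. cis (real j * (t - w))) + (\<Sum>j<n. cis (real j * (- (t + w))))) / 2"
    unfolding f_def by (simp only: sum_divide_distrib[symmetric] sum.distrib)
  also have "cmod \<dots> \<le> (edirk n (t - w) + edirk n (- (t + w))) / 2"
    unfolding edirk_def norm_divide using norm_triangle_ineq by (simp add: divide_right_mono)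
  finally show ?thesis unfolding edirk_minus by simp
qed

lemma cis_add_2pi: "cis (x + 2 * pi) = cis x"
  by (simp add: complex_eq_iff)

lemma sum_edirk_grid_le:
  assumes n: "n > 0"
  shows "(\<Sum>b<2*n. edirk n (x + pi * real b / real n)) \<le> 6 * real n * (1 + ln (real n))"
proof -
  have "(\<Sum>b<2*n. edirk n (x + pi * real b / real n)) \<le> 2 * real n + 2 * real n * (2 + ln (real n))"
    using n
    by (intro grid_sum_le) (simp_all add: edirk_le edirk_sine edirk_cong[OF cis_add_2pi])
  moreover have "0 \<le> real n * ln (real n)" using n by simp
  ultimately show ?thesis by (simp add: algebra_simps)
qed

text \<open>The bound is uniform in \<open>w\<close>, so the modes of the Fourier expansion enter
  later only through the size of their coefficients.\<close>

lemma sum_twisted_row_grid_le: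
  assumes n: "n > 0"
  shows "(\<Sum>b<2*n. cmod (\<Sum>j<n. complex_of_real (h0 j * cos (real j * (t + pi * real b / real n))) * cis (real (n - j) * w)))
    \<le> 7 * real n * (1 + ln (real n))"
proof -
  have "(\<Sum>b<2*n. cmod (\<Sum>j<n. complex_of_real (h0 j * cos (real j * (t + pi * real b / real n))) * cis (real (n - j) * w)))
    \<le> (\<Sum>b<2*n. 1/2 + edirk n ((t - w) + pi * real b / real n) / 2 + edirk n ((t + w) + pi * real b / real n) / 2)"
  proof (rule sum_mono)
    fix b
    show "cmod (\<Sum>j<n. complex_of_real (h0 j * cos (real j * (t + pi * real b / real n))) * cis (real (n - j) * w))
       \<le> 1/2 + edirk n ((t - w) + pi * real b / real n) / 2 + edirk n ((t + w) + pi * real b / real n) / 2"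
      using norm_twisted_row_le[OF n, of "t + pi * real b / real n" w] by (simp add: algebra_simps add_divide_distrib)
  qed
  also have "\<dots> = real n + (\<Sum>b<2*n. edirk n ((t - w) + pi * real b / real n)) / 2
      + (\<Sum>b<2*n. edirk n ((t + w) + pi * real b / real n)) / 2"
    by (simp add: sum.distrib sum_divide_distrib)
  also have "\<dots> \<le> real n + 6 * real n * (1 + ln (real n))"
    using sum_edirk_grid_le[OF n, of "t - w"] sum_edirk_grid_le[OF n, of "t + w"] by simp
  also have "\<dots> \<le> 7 * real n * (1 + ln (real n))"
    using n by (simp add: algebra_simps)
  finally show ?thesis .
qed

lemma abs_sin_add_int_pi: "\<bar>sin (x + of_int k * pi)\<bar> = \<bar>sin x\<bar>"
proof -
  have "sin (of_int k * pi) = 0" by (auto simp: sin_zero_iff_int2)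
  then show ?thesis using sin_zero_abs_cos_one by (simp add: sin_add abs_mult)
qed

text \<open>By \<open>edirk_sine\<close> all these kernels share the numerator
  \<open>|sin (s/2)|\<close>, since \<open>k\<close> moves its argument by a multiple of
  \<open>pi\<close>. Dividing it out leaves reciprocal sines; the factor kept in the second summand
  later cancels the singularity at \<open>s = 0\<close>.\<close>

lemma sum_fourier_coeffs_le:
  assumes n: "n > 0" and s: "sin (s / 2) \<noteq> 0"
  shows "(\<Sum>k<n. edirk n ((s + 2 * pi * real k) / real n)) \<le> 2 * real n + real n * \<bar>sin (s/2)\<bar> * (1 + ln (real n))"
proof -
  define \<sigma> where "\<sigma> = \<bar>sin (s/2)\<bar>"
  have \<sigma>: "\<sigma> > 0" using s by (simp add: \<sigma>_def)
  define F where "F k = edirk n ((s + 2 * pi * of_int k) / real n) / \<sigma>" for k :: int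
  have "(\<Sum>k<n. F (int k)) \<le> 2 * (real n / \<sigma>) + real n * (1 + ln (real n))"
  proof (rule sum_reciprocal_sine_bound)
    show "F (k + int n) = F k" for k
    proof -
      have "(s + 2 * pi * of_int (k + int n)) / real n = (s + 2 * pi * of_int k) / real n + 2 * pi"
        using n by (simp add: field_simps)
      then show ?thesis unfolding F_def by (simp only: edirk_cong[OF cis_add_2pi])
    qed
    show "F k * \<bar>sin (s / (2 * real n) + pi * of_int k / real n)\<bar> \<le> 1" for k
    proof -
      have e: "s / (2 * real n) + pi * of_int k / real n = (s + 2 * pi * of_int k) / real n / 2"
        using n by (simp add: field_simps)
      have "real n * ((s + 2 * pi * of_int k) / real n) / 2 = s / 2 + of_int k * pi"
        using n by (simp add: field_simps)
      then have "\<bar>sin (real n * ((s + 2 * pi * of_int k) / real n) / 2)\<bar> = \<sigma>"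
        unfolding \<sigma>_def by (simp only: abs_sin_add_int_pi)
      then have "edirk n ((s + 2 * pi * of_int k) / real n) * \<bar>sin ((s + 2 * pi * of_int k) / real n / 2)\<bar> = \<sigma>"
        using edirk_sine[of n "(s + 2 * pi * of_int k) / real n"] by simp
      then show ?thesis unfolding F_def e using \<sigma> by (simp add: field_simps)
    qed
    show "F k \<le> real n / \<sigma>" for k
      unfolding F_def using \<sigma> by (intro divide_right_mono edirk_le) simp
  qed (use n \<sigma> in simp_all)
  then have "(\<Sum>k<n. edirk n ((s + 2 * pi * real k) / real n)) / \<sigma> \<le> 2 * (real n / \<sigma>) + real n * (1 + ln (real n))"
    by (simp add: F_def sum_divide_distrib)
  then have "(\<Sum>k<n. edirk n ((s + 2 * pi * real k) / real n)) \<le> (2 * (real n / \<sigma>) + real n * (1 + ln (real n))) * \<sigma>"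
    using \<sigma> by (simp only: pos_divide_le_eq)
  also have "\<dots> = 2 * real n + real n * \<sigma> * (1 + ln (real n))"
    using \<sigma> by (simp add: field_simps)
  finally show ?thesis unfolding \<sigma>_def .
qed

lemma dirk_sine:
  assumes m: "m > 0" and n: "n > 0"
  shows "2 * sin (s/2) * dirk m n s t = (\<Sum>j<n. h0 j * cos (real j * t) * sin ((real (rowlen m n j) - 1/2) * s))"
proof -
  have "2 * sin (s/2) * dirk m n s t = (\<Sum>j<n. h0 j * cos (real j * t) * (2 * sin (s/2) * hdirk (rowlen m n j) s))"
    unfolding dirk_rows[OF n] sum_distrib_left by (simp add: mult_ac)
  then show ?thesis using rowlen_pos[OF m, of _ n] by (simp add: hdirk_sine)
qed

text \<open>The sum of sines in \<open>dirk_sine\<close> is the imaginary part of an exponential sum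
  times a unimodular factor from the half step. By \<open>cis_rowlen\<close> that sum splits into
  twisted rows, one per Fourier mode.\<close>

lemma dirk_sine_le:
  assumes m: "m > 0" and n: "n > 0"
  shows "2 * \<bar>sin (s/2)\<bar> * \<bar>dirk m n s t\<bar> \<le> (\<Sum>k<n. edirk n ((s + 2 * pi * real k) / real n) / real n *
    cmod (\<Sum>j<n. complex_of_real (h0 j * cos (real j * t)) * cis (real (n - j) * (real m * (s + 2 * pi * real k) / real n))))"
proof -
  define c where "c j = h0 j * cos (real j * t)" for j
  define K where "K = rowlen m n"
  define g where "g k = (\<Sum>q<n. cis (real q * ((s + 2 * pi * real k) / real n))) / of_nat n" for k
  define w where "w k = real m * (s + 2 * pi * real k) / real n" for k
  have "2 * sin (s/2) * dirk m n s t = (\<Sum>j<n. c j * sin ((real (K j) - 1/2) * s))"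
    unfolding dirk_sine[OF m n] c_def K_def ..
  also have "\<dots> = Im (cis (- (s/2)) * (\<Sum>j<n. complex_of_real (c j) * cis (real (K j) * s)))"
  proof -
    have "Im (cis (- (s/2)) * (complex_of_real a * cis (real k * s))) = a * sin ((real k - 1/2) * s)" for a k
    proof -
      have e: "(real k - 1/2) * s = real k * s - s/2" by (simp add: algebra_simps)
      show ?thesis unfolding e sin_diff by (simp add: algebra_simps)
    qed
    then show ?thesis unfolding sum_distrib_left Im_sum by simp
  qed
  finally have "\<bar>2 * sin (s/2) * dirk m n s t\<bar> \<le> cmod (\<Sum>j<n. complex_of_real (c j) * cis (real (K j) * s))"
    using abs_Im_le_cmod[of "cis (- (s/2)) * (\<Sum>j<n. complex_of_real (c j) * cis (real (K j) * s))"]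
    by (simp add: norm_mult)
  also have "(\<Sum>j<n. complex_of_real (c j) * cis (real (K j) * s))
     = (\<Sum>j<n. \<Sum>k<n. g k * (complex_of_real (c j) * cis (real (n - j) * w k)))"
    using cis_rowlen[OF m, of _ n s]
    by (intro sum.cong refl) (simp add: K_def g_def w_def sum_distrib_left mult_ac)
  also have "\<dots> = (\<Sum>k<n. g k * (\<Sum>j<n. complex_of_real (c j) * cis (real (n - j) * w k)))"
    by (subst sum.swap) (simp only: sum_distrib_left)
  also have "cmod \<dots> \<le> (\<Sum>k<n. cmod (g k) * cmod (\<Sum>j<n. complex_of_real (c j) * cis (real (n - j) * w k)))"
    unfolding norm_mult[symmetric] by (rule norm_sum)
  finally show ?thesis
    by (simp add: abs_mult g_def norm_divide edirk_def c_def w_def)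
qed

text \<open>The subtracted term collects the Fourier coefficients \<open>k \<noteq> 0\<close>, which stay bounded as \<open>s \<rightarrow> 0\<close>;
  the coefficient \<open>k = 0\<close> contributes the singularity \<open>1 / sin (s/2)\<close>.\<close>

lemma sum_dirk_row_sine_le:
  assumes m: "m > 0" and n: "n > 0"
  shows "((\<Sum>b<2*n. \<bar>dirk m n s (t + pi * real b / real n)\<bar>) - 4 * real n * (1 + ln (real n))\<^sup>2) * \<bar>sin (s/2)\<bar>
    \<le> 7 * real n * (1 + ln (real n))"
proof (cases "sin (s/2) = 0")
  case True
  then show ?thesis using n by simp
next
  case False
  define L where "L = 1 + ln (real n)"
  define B where "B = (\<Sum>b<2*n. \<bar>dirk m n s (t + pi * real b / real n)\<bar>)"
  define \<sigma> where "\<sigma> = \<bar>sin (s/2)\<bar>"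
  have L: "L \<ge> 1" using n by (simp add: L_def)
  have \<sigma>: "\<sigma> \<ge> 0" by (simp add: \<sigma>_def)
  let ?V = "\<lambda>b k. cmod (\<Sum>j<n. complex_of_real (h0 j * cos (real j * (t + pi * real b / real n)))
     * cis (real (n - j) * (real m * (s + 2 * pi * real k) / real n)))"
  let ?g = "\<lambda>k. edirk n ((s + 2 * pi * real k) / real n)"
  have "2 * \<sigma> * B \<le> (\<Sum>b<2*n. \<Sum>k<n. ?g k / real n * ?V b k)"
    unfolding B_def sum_distrib_left \<sigma>_def by (intro sum_mono dirk_sine_le[OF m n])
  also have "\<dots> = (\<Sum>k<n. ?g k / real n * (\<Sum>b<2*n. ?V b k))"
    by (subst sum.swap) (simp only: sum_distrib_left)
  also have "\<dots> \<le> (\<Sum>k<n. ?g k / real n * (7 * real n * L))"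
    unfolding L_def
    by (intro sum_mono mult_left_mono sum_twisted_row_grid_le[OF n] divide_nonneg_nonneg edirk_nonneg) simp
  also have "\<dots> = (\<Sum>k<n. ?g k) * (7 * L)"
    unfolding sum_distrib_right using n by simp
  also have "\<dots> \<le> (2 * real n + real n * \<sigma> * L) * (7 * L)"
    unfolding L_def \<sigma>_def
    by (rule mult_right_mono[OF sum_fourier_coeffs_le[OF n False]]) (use L in \<open>simp add: L_def\<close>)
  finally have "2 * \<sigma> * B \<le> 14 * real n * L + 7 * (real n * L\<^sup>2 * \<sigma>)"
    by (simp add: algebra_simps power2_eq_square)
  \<comment> \<open>After division by 2 the coefficient of this term is 7/2, rounded up to
    4.\<close>
  moreover have "0 \<le> real n * L\<^sup>2 * \<sigma>" using \<sigma> by simp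
  ultimately have "(B - 4 * real n * L\<^sup>2) * \<sigma> \<le> 7 * real n * L"
    by (simp add: algebra_simps)
  then show ?thesis unfolding B_def L_def \<sigma>_def .
qed

text \<open>Holds for every \<open>s\<close> at the price of a factor \<open>m\<close>: each of the
  \<open>m\<close> columns is a one-dimensional kernel in \<open>t\<close>. It caps the sum near the
  zeros of \<open>sin (s/2)\<close>, where \<open>sum_dirk_row_sine_le\<close> is too weak.\<close>

lemma sum_dirk_row_le:
  assumes m: "m > 0" and n: "n > 0"
  shows "(\<Sum>b<2*n. \<bar>dirk m n s (t + pi * real b / real n)\<bar>) \<le> 6 * real m * real n * (1 + ln (real n))"
proof -
  have h: "(\<Sum>b<2*n. \<bar>hdirk (rowlen n m i) (t + pi * real b / real n)\<bar>) \<le> 6 * real n * (1 + ln (real n))" for i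
  proof -
    have "(\<Sum>b<2*n. \<bar>hdirk (rowlen n m i) (t + pi * real b / real n)\<bar>) \<le> 2 * real n + 2 * real n * (2 + ln (real n))"
    proof (rule grid_sum_le)
      show "\<bar>hdirk (rowlen n m i) (x + 2 * pi)\<bar> = \<bar>hdirk (rowlen n m i) x\<bar>" for x
        unfolding hdirk_def cos_nat_periodic ..
      show "\<bar>hdirk (rowlen n m i) x\<bar> \<le> real n" for x
        using abs_hdirk_le[of "rowlen n m i" x] rowlen_le[OF m, of n i] by linarith
    qed (use n abs_hdirk_sine_le in simp_all)
    moreover have "0 \<le> real n * ln (real n)" using n by simp
    ultimately show ?thesis by (simp add: algebra_simps)
  qed
  have "(\<Sum>b<2*n. \<bar>dirk m n s (t + pi * real b / real n)\<bar>)
     \<le> (\<Sum>b<2*n. \<Sum>i<m. \<bar>hdirk (rowlen n m i) (t + pi * real b / real n)\<bar>)"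
  proof (rule sum_mono)
    fix b
    let ?t = "t + pi * real b / real n"
    have "\<bar>dirk m n s ?t\<bar> \<le> (\<Sum>i<m. \<bar>h0 i * cos (real i * s) * hdirk (rowlen n m i) ?t\<bar>)"
      unfolding dirk_commute[of m n] dirk_rows[OF m] by (rule sum_abs)
    also have "\<dots> \<le> (\<Sum>i<m. \<bar>hdirk (rowlen n m i) ?t\<bar>)"
    proof (rule sum_mono)
      fix i
      have "\<bar>h0 i * cos (real i * s)\<bar> \<le> 1" using h0_bounds[of i] by (simp add: abs_mult mult_le_one)
      then show "\<bar>h0 i * cos (real i * s) * hdirk (rowlen n m i) ?t\<bar> \<le> \<bar>hdirk (rowlen n m i) ?t\<bar>"
        unfolding abs_mult[of "h0 i * cos (real i * s)"] by (rule mult_left_le_one_le[rotated 2]) simp_all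
    qed
    finally show "\<bar>dirk m n s ?t\<bar> \<le> (\<Sum>i<m. \<bar>hdirk (rowlen n m i) ?t\<bar>)" .
  qed
  also have "\<dots> = (\<Sum>i<m. \<Sum>b<2*n. \<bar>hdirk (rowlen n m i) (t + pi * real b / real n)\<bar>)"
    by (rule sum.swap)
  also have "\<dots> \<le> (\<Sum>i<m. 6 * real n * (1 + ln (real n)))"
    by (intro sum_mono h)
  finally show ?thesis by simp
qed

lemma sum_dirk_grid_le:
  assumes n: "n > 0" and nm: "n \<le> m"
  shows "(\<Sum>a<2*m. \<Sum>b<2*n. \<bar>dirk m n (s + pi * real a / real m) (t + pi * real b / real n)\<bar>)
    \<le> 50 * real m * real n * (1 + ln (real m))\<^sup>2"
proof -
  define L where "L = 1 + ln (real n)"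
  define L' where "L' = 1 + ln (real m)"
  define B where "B s = (\<Sum>b<2*n. \<bar>dirk m n s (t + pi * real b / real n)\<bar>)" for s
  \<comment> \<open>Normalised so that \<open>sum_dirk_row_sine_le\<close> becomes the sine
    condition of \<open>grid_sum_le\<close>, while \<open>sum_dirk_row_le\<close> caps
    \<open>f\<close> by \<open>m\<close>. The sum over \<open>a\<close> then costs the second
    logarithm.\<close>
  define f where "f s = (B s - 4 * real n * L\<^sup>2) / (7 * real n * L)" for s
  have m: "m > 0" using n nm by simp
  have L: "1 \<le> L" "L \<le> L'" using n nm by (simp_all add: L_def L'_def)
  have p: "0 < 7 * real n * L" using L n by simp
  have "(\<Sum>a<2*m. f (s + pi * real a / real m)) \<le> 2 * real m + 2 * real m * (2 + ln (real m))"
  proof (rule grid_sum_le)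
    show "f (x + 2 * pi) = f x" for x unfolding f_def B_def dirk_periodic ..
    show "f x \<le> real m" for x
    proof -
      have "B x - 4 * real n * L\<^sup>2 \<le> B x" by simp
      also have "B x \<le> 6 * real m * real n * L"
        unfolding B_def L_def by (rule sum_dirk_row_le[OF m n])
      also have "\<dots> \<le> real m * (7 * real n * L)"
        using L by simp
      finally show ?thesis unfolding f_def using p by (simp only: pos_divide_le_eq)
    qed
    show "f x * \<bar>sin (x/2)\<bar> \<le> 1" for x
    proof -
      have "(B x - 4 * real n * L\<^sup>2) * \<bar>sin (x/2)\<bar> \<le> 7 * real n * L"
        unfolding B_def L_def by (rule sum_dirk_row_sine_le[OF m n])
      then show ?thesis unfolding f_def using p by (simp only: times_divide_eq_left pos_divide_le_eq mult_1_left)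
    qed
  qed (use m in simp_all)
  also have "\<dots> \<le> 6 * real m * L'"
    using m by (simp add: L'_def algebra_simps)
  finally have "(\<Sum>a<2*m. f (s + pi * real a / real m)) * (7 * real n * L) \<le> 6 * real m * L' * (7 * real n * L)"
    using p by (intro mult_right_mono) simp_all
  moreover have "B x = f x * (7 * real n * L) + 4 * real n * L\<^sup>2" for x
    using L n by (simp add: f_def)
  ultimately have "(\<Sum>a<2*m. B (s + pi * real a / real m)) \<le> 6 * real m * L' * (7 * real n * L) + 2 * real m * (4 * real n * L\<^sup>2)"
    by (simp add: sum.distrib sum_distrib_right)
  also have "\<dots> = 42 * real m * real n * (L' * L) + 8 * real m * real n * (L * L)"
    by (simp add: power2_eq_square)
  also have "\<dots> \<le> 42 * real m * real n * (L' * L') + 8 * real m * real n * (L' * L')"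
    using L by (intro add_mono mult_left_mono mult_mono) simp_all
  also have "\<dots> = 50 * real m * real n * L'\<^sup>2" by (simp add: power2_eq_square)
  finally show ?thesis unfolding B_def L'_def .
qed

section \<open>From the kernel to the Lebesgue function\<close>

lemma hw2_tri: "(i, j) \<in> tri m n \<Longrightarrow> hw2 m n (i, j) = h0 i * h0 j"
  using tri_bounds[of i j m n] by (auto simp: hw2_def hw_def h0_def)

text \<open>Product-to-sum formulas in both variables turn the triangle part into four translates of
  the kernel, one for each choice of signs. The corner frequency \<open>(0, n)\<close> remains as a
  separate bounded term.\<close>

lemma lag_eq_dirk:
  assumes m: "m > 0" and n: "n > 0"
  defines "\<alpha> \<equiv> \<lambda>a. pi * real a / real m" and "\<beta> \<equiv> \<lambda>b. pi * real b / real n"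
  shows "lag m n (a, b) (x, y) = 2 * hw2 m n (a, b) / (real m * real n) *
    (dirk m n (arccos x + \<alpha> a) (arccos y + \<beta> b) + dirk m n (arccos x + \<alpha> a) (- arccos y + \<beta> b)
    + dirk m n (- arccos x + \<alpha> a) (arccos y + \<beta> b) + dirk m n (- arccos x + \<alpha> a) (- arccos y + \<beta> b)
    + (-1) ^ b * Cheb n y)"
proof -
  let ?d = "\<lambda>i j s t. h0 i * h0 j * (cos (real i * s) * cos (real j * t))"
  define c where "c = 2 * hw2 m n (a, b) / (real m * real n)"
  have prod4: "hw2 m n (i, j) * tcos m n (i, j) (a, b) * (Cheb i x * Cheb j y)
     = (?d i j (arccos x + \<alpha> a) (arccos y + \<beta> b) + ?d i j (arccos x + \<alpha> a) (- arccos y + \<beta> b)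
      + ?d i j (- arccos x + \<alpha> a) (arccos y + \<beta> b) + ?d i j (- arccos x + \<alpha> a) (- arccos y + \<beta> b)) / 4"
    if "(i, j) \<in> tri m n" for i j
  proof -
    have cc: "cos (real k * (u + v)) + cos (real k * (- u + v)) = 2 * cos (real k * v) * cos (real k * u)" for k u v
    proof -
      have e: "real k * (u + v) = real k * v + real k * u" "real k * (- u + v) = real k * v - real k * u"
        by (simp_all add: algebra_simps)
      show ?thesis unfolding e cos_add cos_diff by simp
    qed
    have "?d i j (arccos x + \<alpha> a) (arccos y + \<beta> b) + ?d i j (arccos x + \<alpha> a) (- arccos y + \<beta> b)
      + ?d i j (- arccos x + \<alpha> a) (arccos y + \<beta> b) + ?d i j (- arccos x + \<alpha> a) (- arccos y + \<beta> b)
      = h0 i * h0 j * ((cos (real i * (arccos x + \<alpha> a)) + cos (real i * (- arccos x + \<alpha> a)))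
        * (cos (real j * (arccos y + \<beta> b)) + cos (real j * (- arccos y + \<beta> b))))"
      by (simp add: algebra_simps)
    then show ?thesis unfolding cc
      by (simp add: hw2_tri[OF that] tcos_def Cheb_def \<alpha>_def \<beta>_def mult_ac)
  qed
  have corner: "hw2 m n (0, n) * tcos m n (0, n) (a, b) * (Cheb 0 x * Cheb n y) = (-1) ^ b * Cheb n y / 4"
    using n by (simp add: hw2_def hw_def tcos_def Cheb_def)
  have "lag m n (a, b) (x, y) = 4 * c * (\<Sum>(i, j)\<in>insert (0, n) (tri m n).
     hw2 m n (i, j) * tcos m n (i, j) (a, b) * (Cheb i x * Cheb j y))"
    unfolding lag_def c_def sum_distrib_left by (simp add: split_def mult_ac)
  also have "\<dots> = 4 * c * ((-1) ^ b * Cheb n y / 4 + (\<Sum>(i, j)\<in>tri m n.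
     hw2 m n (i, j) * tcos m n (i, j) (a, b) * (Cheb i x * Cheb j y)))"
    using finite_tri corner_notin_tri corner by (subst sum.insert) simp_all
  also have "(\<Sum>(i, j)\<in>tri m n. hw2 m n (i, j) * tcos m n (i, j) (a, b) * (Cheb i x * Cheb j y))
    = (dirk m n (arccos x + \<alpha> a) (arccos y + \<beta> b) + dirk m n (arccos x + \<alpha> a) (- arccos y + \<beta> b)
    + dirk m n (- arccos x + \<alpha> a) (arccos y + \<beta> b) + dirk m n (- arccos x + \<alpha> a) (- arccos y + \<beta> b)) / 4"
    unfolding dirk_def sum.distrib[symmetric] sum_divide_distrib
    by (rule sum.cong[OF refl]) (auto simp: prod4)
  finally show ?thesis unfolding c_def[symmetric] by (simp add: algebra_simps)
qed

lemma abs_Cheb_le_1: "\<bar>Cheb i x\<bar> \<le> 1"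
  by (simp add: Cheb_def)

lemma hw2_le_1: "hw2 m n z \<le> 1"
  by (auto simp: hw2_def hw_def split: prod.splits)

lemma sum_abs_lag_le:
  assumes n: "n > 0" and nm: "n \<le> m"
  shows "(\<Sum>k\<in>even_grid m n. \<bar>lag m n k z\<bar>) \<le> 408 * (1 + ln (real m))\<^sup>2"
proof -
  obtain x y where z: "z = (x, y)" by (cases z)
  have m: "m > 0" using n nm by simp
  define L where "L = 1 + ln (real m)"
  have L: "L \<ge> 1" using m by (simp add: L_def)
  define d where "d = (\<lambda>s t a b. \<bar>dirk m n (s + pi * real a / real m) (t + pi * real b / real n)\<bar>)"
  define \<theta> where "\<theta> = arccos x"
  define \<phi> where "\<phi> = arccos y"
  define c where "c = 2 / (real m * real n)"
  have c: "c \<ge> 0" by (simp add: c_def)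
  have D: "(\<Sum>a<2*m. \<Sum>b<2*n. d s t a b) \<le> 50 * real m * real n * L\<^sup>2" for s t
    unfolding d_def L_def by (rule sum_dirk_grid_le[OF n nm])
  define h where "h a b = c * (d \<theta> \<phi> a b + d \<theta> (-\<phi>) a b + d (-\<theta>) \<phi> a b + d (-\<theta>) (-\<phi>) a b + 1)" for a b
  have hnn: "0 \<le> h a b" for a b using c by (simp add: h_def d_def)
  have le: "\<bar>lag m n (a, b) z\<bar> \<le> h a b" for a b
  proof -
    let ?S = "dirk m n (arccos x + pi * real a / real m) (arccos y + pi * real b / real n)
      + dirk m n (arccos x + pi * real a / real m) (- arccos y + pi * real b / real n)
      + dirk m n (- arccos x + pi * real a / real m) (arccos y + pi * real b / real n)
      + dirk m n (- arccos x + pi * real a / real m) (- arccos y + pi * real b / real n)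
      + (-1) ^ b * Cheb n y"
    have "\<bar>lag m n (a, b) z\<bar> = hw2 m n (a, b) * (c * \<bar>?S\<bar>)"
      unfolding z lag_eq_dirk[OF m n] c_def abs_mult using hw2_pos[of m n "(a, b)"] by simp
    also have "\<dots> \<le> c * \<bar>?S\<bar>"
      using hw2_le_1 hw2_pos[of m n "(a, b)"] c by (intro mult_left_le_one_le) simp_all
    also have "\<dots> \<le> h a b"
    proof -
      have "\<bar>(-1) ^ b * Cheb n y\<bar> \<le> 1" using abs_Cheb_le_1 by (simp add: abs_mult)
      then have "\<bar>?S\<bar> \<le> d \<theta> \<phi> a b + d \<theta> (-\<phi>) a b + d (-\<theta>) \<phi> a b + d (-\<theta>) (-\<phi>) a b + 1"
        unfolding d_def \<theta>_def \<phi>_def by linarith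
      then show ?thesis unfolding h_def using c by (rule mult_left_mono)
    qed
    finally show ?thesis .
  qed
  have "(\<Sum>k\<in>even_grid m n. \<bar>lag m n k z\<bar>) \<le> (\<Sum>(a, b)\<in>even_grid m n. h a b)"
    using le by (intro sum_mono) auto
  \<comment> \<open>Nonnegative terms are added to reach a full period in both variables, where
    \<open>sum_dirk_grid_le\<close> applies.\<close>
  also have "\<dots> \<le> (\<Sum>(a, b)\<in>{..<2*m} \<times> {..<2*n}. h a b)"
    using hnn m n by (intro sum_mono2) (auto simp: even_grid_def)
  also have "\<dots> = (\<Sum>a<2*m. \<Sum>b<2*n. h a b)"
    by (rule sum.cartesian_product[symmetric])
  also have "\<dots> = c * ((\<Sum>a<2*m. \<Sum>b<2*n. d \<theta> \<phi> a b) + (\<Sum>a<2*m. \<Sum>b<2*n. d \<theta> (-\<phi>) a b)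
      + (\<Sum>a<2*m. \<Sum>b<2*n. d (-\<theta>) \<phi> a b) + (\<Sum>a<2*m. \<Sum>b<2*n. d (-\<theta>) (-\<phi>) a b) + 4 * real m * real n)"
    unfolding h_def by (simp add: sum_distrib_left[symmetric] sum.distrib)
  also have "\<dots> \<le> c * (50 * real m * real n * L\<^sup>2 + 50 * real m * real n * L\<^sup>2
      + 50 * real m * real n * L\<^sup>2 + 50 * real m * real n * L\<^sup>2 + 4 * real m * real n)"
    using c by (intro mult_left_mono add_mono D order_refl)
  \<comment> \<open>The four kernels give \<open>2 * (4 * 50)\<close>; the corner term, counted at
    each of the \<open>4 * m * n\<close> grid points, gives \<open>2 * 4\<close>.\<close>
  also have "\<dots> = 400 * L\<^sup>2 + 8"
    using m n by (simp add: c_def field_simps)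
  also have "\<dots> \<le> 408 * L\<^sup>2"
    using L by simp
  finally show ?thesis unfolding L_def .
qed

section \<open>Lower bound\<close>

text \<open>The sum is the right-hand side of \<open>dirk_sine\<close> with linearised row lengths,
  where \<open>\<sigma>\<close> stands for \<open>m * s / n\<close>.\<close>

lemma conjugate_convolution:
  "2 * (cos \<sigma> - cos t) * (\<Sum>j<n. h0 j * cos (real j * t) * sin (real (n - j) * \<sigma>))
    = sin \<sigma> * (cos (real n * \<sigma>) - cos (real n * t))"
proof (cases "n > 0")
  case True
  \<comment> \<open>The Casoratian of the sequences \<open>cos (j t)\<close> and
    \<open>sin ((n - j) \<sigma>)\<close>. Their three-term recurrences have coefficients
    \<open>2 cos t\<close> and \<open>2 cos \<sigma>\<close>, so its increments are the summands
    times \<open>2 (cos \<sigma> - cos t)\<close>.\<close>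
  define T where "T j = cos (real j * t) * sin ((real n - real j + 1) * \<sigma>) - cos ((real j - 1) * t) * sin ((real n - real j) * \<sigma>)" for j
  have step: "2 * (cos \<sigma> - cos t) * (cos (real j * t) * sin ((real n - real j) * \<sigma>)) = T j - T (Suc j)" for j
  proof -
    have e: "(real n - real j + 1) * \<sigma> = (real n - real j) * \<sigma> + \<sigma>" "(real j - 1) * t = real j * t - t"
      "real (Suc j) * t = real j * t + t" "(real n - real (Suc j) + 1) * \<sigma> = (real n - real j) * \<sigma>"
      "(real (Suc j) - 1) * t = real j * t" "(real n - real (Suc j)) * \<sigma> = (real n - real j) * \<sigma> - \<sigma>"
      by (simp_all add: algebra_simps)
    show ?thesis unfolding T_def e cos_add cos_diff sin_add sin_diff by (simp add: algebra_simps)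
  qed
  have "(\<Sum>j<n. h0 j * cos (real j * t) * sin (real (n - j) * \<sigma>))
    = (\<Sum>j<n. h0 j * (cos (real j * t) * sin ((real n - real j) * \<sigma>)))"
    by (intro sum.cong refl) (simp add: of_nat_diff)
  also have "\<dots> = (\<Sum>j<n. cos (real j * t) * sin ((real n - real j) * \<sigma>)) - sin (real n * \<sigma>) / 2"
    unfolding sum_h0[OF True] by simp
  finally have "2 * (cos \<sigma> - cos t) * (\<Sum>j<n. h0 j * cos (real j * t) * sin (real (n - j) * \<sigma>))
    = (\<Sum>j<n. T j - T (Suc j)) - (cos \<sigma> - cos t) * sin (real n * \<sigma>)"
    by (simp only: step[symmetric] sum_distrib_left[symmetric]) (simp add: algebra_simps)
  also have "\<dots> = T 0 - T n - (cos \<sigma> - cos t) * sin (real n * \<sigma>)"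
    unfolding sum_lessThan_telescope' ..
  also have "\<dots> = sin \<sigma> * (cos (real n * \<sigma>) - cos (real n * t))"
  proof -
    have e: "(real n + 1) * \<sigma> = real n * \<sigma> + \<sigma>" by (simp add: algebra_simps)
    show ?thesis by (simp add: T_def e sin_add algebra_simps)
  qed
  finally show ?thesis .
qed simp

lemma abs_sin_diff_le: "\<bar>sin x - sin y\<bar> \<le> \<bar>x - (y::real)\<bar>"
proof -
  have "\<bar>sin x - sin y\<bar> = 2 * (\<bar>sin ((x - y) / 2)\<bar> * \<bar>cos ((x + y) / 2)\<bar>)"
    unfolding sin_diff_sin by (simp add: abs_mult)
  also have "\<dots> \<le> 2 * (\<bar>(x - y) / 2\<bar> * 1)"
    by (intro mult_left_mono mult_mono abs_sin_x_le_abs_x) simp_all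
  finally show ?thesis by simp
qed

text \<open>This replaces the row length by \<open>m (n - j) / n + 1/2\<close>. The crude error suffices below since only
  about \<open>n\<close> nodes near a corner of the square are used.\<close>

lemma dirk_conjugate_approx:
  assumes m: "m > 0" and n: "n > 0"
  shows "\<bar>2 * sin (s/2) * dirk m n s t - (\<Sum>j<n. h0 j * cos (real j * t) * sin (real (n - j) * (real m * s / real n)))\<bar>
    \<le> real n * \<bar>s\<bar> / 2"
proof -
  define K where "K = rowlen m n"
  have "2 * sin (s/2) * dirk m n s t - (\<Sum>j<n. h0 j * cos (real j * t) * sin (real (n - j) * (real m * s / real n)))
    = (\<Sum>j<n. h0 j * cos (real j * t) * (sin ((real (K j) - 1/2) * s) - sin (real (n - j) * (real m * s / real n))))"
    unfolding dirk_sine[OF m n] K_def by (simp only: sum_subtractf[symmetric] right_diff_distrib)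
  also have "\<bar>\<dots>\<bar> \<le> (\<Sum>j<n. \<bar>s\<bar> / 2)"
  proof (rule order_trans[OF sum_abs sum_mono])
    fix j assume "j \<in> {..<n}"
    then have "j < n" by simp
    then obtain r where r: "K j * n = m * (n - j) + r" "r < n" unfolding K_def by (rule rowlen_bounds[OF m])
    have "real (K j) * real n = real m * real (n - j) + real r"
      using r(1) unfolding of_nat_mult[symmetric] of_nat_add[symmetric] by simp
    then have K: "real (K j) = real m * real (n - j) / real n + real r / real n" using n by (simp add: field_simps)
    \<comment> \<open>The rounding error \<open>r / n\<close> lies in \<open>[0, 1)\<close>; the
      half step of the one-dimensional kernel centres it.\<close>
    have "\<bar>real r / real n - 1/2\<bar> \<le> 1/2" using r(2) by (simp add: abs_le_iff field_simps)
    then have "\<bar>real r / real n - 1/2\<bar> * \<bar>s\<bar> \<le> 1/2 * \<bar>s\<bar>" by (rule mult_right_mono) simp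
    moreover have "(real (K j) - 1/2) * s - real (n - j) * (real m * s / real n) = (real r / real n - 1/2) * s"
      unfolding K by (simp add: algebra_simps)
    ultimately have "\<bar>(real (K j) - 1/2) * s - real (n - j) * (real m * s / real n)\<bar> \<le> \<bar>s\<bar> / 2"
      by (simp add: abs_mult)
    then have "\<bar>sin ((real (K j) - 1/2) * s) - sin (real (n - j) * (real m * s / real n))\<bar> \<le> \<bar>s\<bar> / 2"
      using abs_sin_diff_le order_trans by blast
    moreover have "\<bar>h0 j * cos (real j * t)\<bar> \<le> 1" using h0_bounds[of j] by (simp add: abs_mult mult_le_one)
    ultimately show "\<bar>h0 j * cos (real j * t) * (sin ((real (K j) - 1/2) * s) - sin (real (n - j) * (real m * s / real n)))\<bar> \<le> \<bar>s\<bar> / 2"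
      unfolding abs_mult[of "h0 j * cos (real j * t)"] using mult_mono[of "\<bar>h0 j * cos (real j * t)\<bar>" 1] by fastforce
  qed
  finally show ?thesis by simp
qed

lemma pi_cube_le: "pi ^ 3 \<le> 64"
  using power_mono[of pi 4 3] pi_less_4 by simp

text \<open>The point \<open>(1, cos (pi / n))\<close> lies on the odd grid. There \<open>cos (n t)\<close> and \<open>cos (m s)\<close> have opposite
  signs, so the numerator in \<open>conjugate_convolution\<close> does not cancel.\<close>

lemma signed_dirk_lower:
  assumes mn: "m > 0" "n > 0" "n \<le> m" and y: "1 \<le> y" and a: "y \<le> a" "2 * a \<le> n" and b: "a + 2 * y + 1 \<le> n"
  defines "s \<equiv> pi * real a / real m"
    and "t1 \<equiv> pi * real (a + 2 * y - 1) / real n" and "t2 \<equiv> pi * real (a + 2 * y + 1) / real n"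
  shows "(-1) ^ a * (dirk m n s t1 + dirk m n s t2)
    \<ge> 4 * real n * real m / (pi ^ 3 * (2 * real y - 1) * (2 * real a + 2 * real y - 1)) - 2 * real n"
proof -
  define \<sigma> where "\<sigma> = pi * real a / real n"
  \<comment> \<open>\<open>P\<close> and \<open>Q\<close> are the difference and the sum of
    \<open>t1\<close> and \<open>\<sigma>\<close> in units of \<open>pi / n\<close>.\<close>
  define P where "P = 2 * real y - 1"
  define Q where "Q = 2 * real a + 2 * real y - 1"
  define W where "W t = (\<Sum>j<n. h0 j * cos (real j * t) * sin (real (n - j) * \<sigma>))" for t
  define e :: real where "e = (-1) ^ a"
  define c where "c = 2 * sin (s / 2)"
  have ee: "e * e = 1" "\<bar>e\<bar> = 1" by (simp_all add: e_def flip: power_add)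
  have P: "P \<ge> 1" and Q: "Q \<ge> 1" using y by (simp_all add: P_def Q_def)
  have apos: "real a > 0" using y a by simp
  have \<sigma>: "0 < \<sigma>" "\<sigma> \<le> pi / 2"
    using apos a(2) mn by (simp_all add: \<sigma>_def field_simps)
  have t1s: "t1 + \<sigma> = pi * Q / real n" "t1 - \<sigma> = pi * P / real n"
  proof -
    have r: "real (a + 2 * y - 1) = real a + 2 * real y - 1" using y by (simp add: of_nat_diff)
    show "t1 + \<sigma> = pi * Q / real n" "t1 - \<sigma> = pi * P / real n"
      unfolding t1_def \<sigma>_def r P_def Q_def using mn by (simp_all add: field_simps)
  qed
  have "0 < pi * P / real n" using P mn by simp
  then have "\<sigma> < t1" using t1s(2) by linarith
  have "t1 < t2" using mn y by (simp add: t1_def t2_def divide_strict_right_mono)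
  have "t2 \<le> pi * real n / real n" unfolding t2_def using b by (intro divide_right_mono mult_left_mono) simp_all
  then have "t2 \<le> pi" using mn by simp
  have dcos1: "0 < cos \<sigma> - cos t1" and dcos2: "0 < cos \<sigma> - cos t2"
    using cos_monotone_0_pi[of \<sigma> t1] cos_monotone_0_pi[of \<sigma> t2] \<sigma> \<open>\<sigma> < t1\<close> \<open>t1 < t2\<close> \<open>t2 \<le> pi\<close> by simp_all
  have cosn\<sigma>: "cos (real n * \<sigma>) = e" using mn by (simp add: \<sigma>_def e_def mult.commute)
  \<comment> \<open>In units of \<open>pi / n\<close> both angles differ from
    \<open>\<sigma>\<close> by an odd number, whence the opposite sign.\<close>
  have cosnt: "cos (real n * t1) = - e" "cos (real n * t2) = - e"
  proof -
    have n1: "real n * t1 = real (a + 2 * y - 1) * pi" "real n * t2 = real (a + 2 * y + 1) * pi"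
      using mn by (simp_all add: t1_def t2_def)
    obtain y' where y': "y = Suc y'" using y by (cases y) simp_all
    show "cos (real n * t1) = - e" unfolding n1 cos_npi by (simp add: y' e_def power_add power_mult)
    show "cos (real n * t2) = - e" unfolding n1 cos_npi by (simp add: e_def power_add power_mult)
  qed
  have W: "e * W t = sin \<sigma> / (cos \<sigma> - cos t)" if "cos (real n * t) = - e" "0 < cos \<sigma> - cos t" for t
  proof -
    have "2 * (cos \<sigma> - cos t) * W t = sin \<sigma> * (2 * e)"
      using conjugate_convolution[of \<sigma> t n] that cosn\<sigma> by (simp add: W_def)
    then have "W t = sin \<sigma> * e / (cos \<sigma> - cos t)" using that(2) by (simp add: field_simps)
    then have "e * W t = (e * e) * (sin \<sigma> / (cos \<sigma> - cos t))" by simp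
    then show ?thesis unfolding ee by simp
  qed
  have sin\<sigma>: "2 * real a / real n \<le> sin \<sigma>" using jordan_sine[of \<sigma>] \<sigma> by (simp add: \<sigma>_def)
  then have sin\<sigma>0: "0 \<le> sin \<sigma>" by (rule order_trans[rotated]) simp
  \<comment> \<open>Both contributions have the sign \<open>e\<close>, so the one at
    \<open>t2\<close> may be dropped.\<close>
  have "e * W t2 \<ge> 0" unfolding W[OF cosnt(2) dcos2] using sin\<sigma>0 dcos2 by simp
  moreover have "e * W t1 \<ge> 4 * real a * real n / (pi\<^sup>2 * P * Q)"
  proof -
    have "cos \<sigma> - cos t1 = 2 * (sin ((\<sigma> + t1) / 2) * sin ((t1 - \<sigma>) / 2))" unfolding cos_diff_cos by simp
    also have "\<dots> \<le> 2 * ((\<sigma> + t1) / 2 * ((t1 - \<sigma>) / 2))"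
      using \<sigma> \<open>\<sigma> < t1\<close> \<open>t1 < t2\<close> \<open>t2 \<le> pi\<close>
      by (intro mult_left_mono mult_mono sin_x_le_x sin_ge_zero) simp_all
    also have "\<dots> = (t1 + \<sigma>) * (t1 - \<sigma>) / 2" by simp
    also have "\<dots> = pi\<^sup>2 * P * Q / (2 * (real n)\<^sup>2)" unfolding t1s by (simp add: power2_eq_square mult_ac)
    finally have "(2 * real a / real n) / (pi\<^sup>2 * P * Q / (2 * (real n)\<^sup>2)) \<le> sin \<sigma> / (cos \<sigma> - cos t1)"
      using sin\<sigma> dcos1 by (intro frac_le sin\<sigma>0) simp_all
    moreover have "(2 * real a / real n) / (pi\<^sup>2 * P * Q / (2 * (real n)\<^sup>2)) = 4 * real a * real n / (pi\<^sup>2 * P * Q)"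
      using mn P Q by (simp add: field_simps power2_eq_square)
    ultimately show ?thesis unfolding W[OF cosnt(1) dcos1] by simp
  qed
  moreover have approx: "e * (c * dirk m n s t) \<ge> e * W t - real n * s / 2" for t
  proof -
    have sm: "real m * s / real n = \<sigma>" using mn by (simp add: s_def \<sigma>_def)
    have "\<bar>c * dirk m n s t - W t\<bar> \<le> real n * s / 2"
      using dirk_conjugate_approx[OF mn(1,2), of s t] unfolding sm c_def W_def by (simp add: s_def)
    then have "\<bar>e * (c * dirk m n s t - W t)\<bar> \<le> real n * s / 2" unfolding abs_mult ee by simp
    then have "- (e * (c * dirk m n s t - W t)) \<le> real n * s / 2" by (rule abs_le_D2)
    then show ?thesis by (simp add: right_diff_distrib)
  qed
  ultimately have main: "e * (c * dirk m n s t1) + e * (c * dirk m n s t2) \<ge> 4 * real a * real n / (pi\<^sup>2 * P * Q) - real n * s"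
    using approx[of t1] approx[of t2] by linarith
  have s: "0 < s" "s \<le> pi" using apos mn a(2) by (simp_all add: s_def field_simps)
  have c: "2 * s / pi \<le> c" "c \<le> s"
    using jordan_sine[of "s/2"] sin_x_le_x[of "s/2"] s by (simp_all add: c_def)
  have c0: "0 < c" using less_le_trans[OF _ c(1)] s by simp
  define A where "A = 4 * real a * real n / (pi\<^sup>2 * P * Q)"
  have A0: "0 \<le> A" using P Q by (simp add: A_def)
  have "A - real n * s \<le> c * (e * (dirk m n s t1 + dirk m n s t2))"
    using main by (simp add: A_def algebra_simps)
  then have "(A - real n * s) / c \<le> e * (dirk m n s t1 + dirk m n s t2)"
    using c0 by (simp add: pos_divide_le_eq mult.commute)
  \<comment> \<open>The bound \<open>c \<le> s\<close> serves the main term; the lower bound on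
    \<open>c\<close> serves the error.\<close>
  moreover have "A / s \<le> A / c" using A0 c0 c(2) by (intro divide_left_mono) simp_all
  moreover have "real n * s / c \<le> 2 * real n"
  proof -
    have "2 * s \<le> c * pi" using c(1) by (simp add: pos_divide_le_eq)
    also have "\<dots> \<le> c * 4" using c0 pi_less_4 by (intro mult_left_mono) simp_all
    finally have "s \<le> 2 * c" by simp
    then have "real n * s \<le> 2 * real n * c" using mult_left_mono[of s "2 * c" "real n"] by simp
    then show ?thesis using c0 by (simp add: pos_divide_le_eq)
  qed
  moreover have "A / s = 4 * real n * real m / (pi ^ 3 * P * Q)"
    using apos mn by (simp add: A_def s_def power3_eq_cube power2_eq_square mult_ac)
  ultimately show ?thesis unfolding e_def P_def[symmetric] Q_def[symmetric] by (simp add: diff_divide_distrib)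
qed

text \<open>At \<open>x = 1\<close> the four kernels coincide in pairs, leaving twice the sum
  treated in \<open>signed_dirk_lower\<close>. The nodes \<open>(a, a + 2 * y)\<close> are on the
  even grid and off its boundary, so their weight \<open>hw2\<close> is 1.\<close>

lemma abs_lag_corner_lower:
  assumes n: "n > 0" and nm: "n < m" and y: "1 \<le> y" and a: "y \<le> a" "2 * a \<le> n" and b: "a + 2 * y + 1 \<le> n"
  shows "1 / (32 * real a * real y) - 10 / real n \<le> \<bar>lag m n (a, a + 2 * y) (1, cos (pi / real n))\<bar>"
proof -
  have mn: "m > 0" "n \<le> m" using n nm by simp_all
  define s where "s = pi * real a / real m"
  define t1 where "t1 = pi * real (a + 2 * y - 1) / real n"
  define t2 where "t2 = pi * real (a + 2 * y + 1) / real n"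
  have arc: "arccos (cos (pi / real n)) = pi / real n"
    using n by (intro arccos_cos) (simp_all add: field_simps)
  have hw1: "hw2 m n (a, a + 2 * y) = 1" using y a b nm by (simp add: hw2_def hw_def)
  have ta: "pi / real n + pi * real (a + 2 * y) / real n = t2" "- (pi / real n) + pi * real (a + 2 * y) / real n = t1"
  proof -
    have r: "real (a + 2 * y - 1) = real (a + 2 * y) - 1" "real (a + 2 * y + 1) = real (a + 2 * y) + 1"
      using y by (simp_all add: of_nat_diff)
    show "pi / real n + pi * real (a + 2 * y) / real n = t2" "- (pi / real n) + pi * real (a + 2 * y) / real n = t1"
      unfolding t1_def t2_def r using n by (simp_all add: field_simps)
  qed
  have Ch: "Cheb n (cos (pi / real n)) = -1" using n by (simp add: Cheb_def arc)
  have lag_eq: "lag m n (a, a + 2 * y) (1, cos (pi / real n)) =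
     2 / (real m * real n) * (2 * (dirk m n s t1 + dirk m n s t2) - (-1) ^ a)"
    unfolding lag_eq_dirk[OF mn(1) n] arc hw1 arccos_1 Ch ta add_0_left minus_zero s_def[symmetric]
    by (simp add: power_add power_mult)
  have "(-1) ^ a * lag m n (a, a + 2 * y) (1, cos (pi / real n))
     = 2 / (real m * real n) * (2 * ((-1) ^ a * (dirk m n s t1 + dirk m n s t2)) - 1)"
  proof -
    have g: "e * (c * (2 * S - e)) = c * (2 * (e * S) - 1)" if "e * e = 1" for c e S :: real
      using that by (simp add: algebra_simps)
    show ?thesis unfolding lag_eq by (rule g) (simp flip: power_add)
  qed
  moreover have "\<dots> \<ge> 2 / (real m * real n) * (2 * (n * m / (32 * (real a * real y) * 4) - 2 * real n) - 1)"
  proof -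
    have PQ: "0 < (2 * real y - 1) * (2 * real a + 2 * real y - 1)" using y by simp
    have "pi ^ 3 * (2 * real y - 1) * (2 * real a + 2 * real y - 1) \<le> 64 * ((2 * real y) * (4 * real a))"
    proof -
      \<comment> \<open>Here \<open>y \<le> a\<close> makes the second factor comparable to
        \<open>a\<close>.\<close>
      have "(2 * real y - 1) * (2 * real a + 2 * real y - 1) \<le> (2 * real y) * (4 * real a)"
        using y a by (intro mult_mono) simp_all
      then have "pi ^ 3 * ((2 * real y - 1) * (2 * real a + 2 * real y - 1)) \<le> 64 * ((2 * real y) * (4 * real a))"
        by (rule mult_mono[OF pi_cube_le]) (use PQ in simp_all)
      then show ?thesis by (simp only: mult.assoc)
    qed
    then have "4 * real n * real m / (64 * ((2 * real y) * (4 * real a)))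
       \<le> 4 * real n * real m / (pi ^ 3 * (2 * real y - 1) * (2 * real a + 2 * real y - 1))"
    proof (rule frac_le[rotated 3])
      show "0 < pi ^ 3 * (2 * real y - 1) * (2 * real a + 2 * real y - 1)"
        unfolding mult.assoc by (rule mult_pos_pos[OF _ PQ]) simp
    qed simp_all
    moreover have "4 * real n * real m / (64 * ((2 * real y) * (4 * real a))) = n * m / (32 * (real a * real y) * 4)"
      by simp
    ultimately have "n * m / (32 * (real a * real y) * 4) - 2 * real n \<le> (-1) ^ a * (dirk m n s t1 + dirk m n s t2)"
      using signed_dirk_lower[OF mn(1) n mn(2) y a b] unfolding s_def t1_def t2_def by linarith
    then show ?thesis by (intro mult_left_mono diff_mono) simp_all
  qed
  moreover have "2 / (real m * real n) * (2 * (n * m / (32 * (real a * real y) * 4) - 2 * real n) - 1)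
     = 1 / (32 * real a * real y) - (8 / real m + 2 / (real m * real n))"
    using mn n y a by (simp add: field_simps)
  \<comment> \<open>The error is measured against \<open>n\<close>, as it will be summed over at
    most \<open>n\<close> nodes.\<close>
  moreover have "8 / real m + 2 / (real m * real n) \<le> 10 / real n"
  proof -
    have "8 / real m \<le> 8 / real n" using mn n by (intro divide_left_mono) simp_all
    moreover have "real n \<le> real m * real n"
      using mn by (simp flip: of_nat_mult)
    then have "2 / (real m * real n) \<le> 2 / real n" using mn n by (intro divide_left_mono) simp_all
    ultimately show ?thesis by (simp add: add_divide_distrib[symmetric])
  qed
  moreover have "(-1) ^ a * lag m n (a, a + 2 * y) (1, cos (pi / real n)) \<le> \<bar>lag m n (a, a + 2 * y) (1, cos (pi / real n))\<bar>"
    using abs_ge_self[of "(-1) ^ a * lag m n (a, a + 2 * y) (1, cos (pi / real n))"] by (simp add: abs_mult)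
  ultimately show ?thesis by linarith
qed

text \<open>The square of \<open>harm R\<close> is the sum over all pairs; by symmetry the triangle
  with its diagonal carries at least half of it.\<close>

lemma triangular_harm_ge: "(harm R)\<^sup>2 / 2 \<le> (\<Sum>a=1..R. \<Sum>y=1..a. 1 / (real a * real y))"
proof (induction R)
  case 0
  then show ?case by (simp add: harm_def)
next
  case (Suc R)
  have row: "(\<Sum>y=1..Suc R. 1 / (real (Suc R) * real y)) = harm (Suc R) / real (Suc R)"
    unfolding harm_def sum_divide_distrib by (rule sum.cong[OF refl]) (simp add: field_simps)
  define q where "q = 1 / real (Suc R)"
  have "harm (Suc R) = harm R + q" by (simp add: harm_Suc q_def inverse_eq_divide)
  then have "(harm (Suc R))\<^sup>2 / 2 = (harm R)\<^sup>2 / 2 + harm (Suc R) * q - q\<^sup>2 / 2"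
    by (simp add: power2_eq_square algebra_simps add_divide_distrib)
  also have "\<dots> \<le> (harm R)\<^sup>2 / 2 + harm (Suc R) * q" by simp
  also have "\<dots> \<le> (\<Sum>a=1..R. \<Sum>y=1..a. 1 / (real a * real y)) + harm (Suc R) / real (Suc R)"
    using Suc by (simp add: q_def)
  also have "\<dots> = (\<Sum>a=1..Suc R. \<Sum>y=1..a. 1 / (real a * real y))"
    unfolding row[symmetric] by simp
  finally show ?case .
qed

lemma sum_abs_lag_corner_lower:
  assumes n: "16 \<le> n" and nm: "n < m"
  shows "(ln (real n))\<^sup>2 / 256 - 10 \<le> (\<Sum>k\<in>even_grid m n. \<bar>lag m n k (1, cos (pi / real n))\<bar>)"
proof -
  define z where "z = (1::real, cos (pi / real n))"
  \<comment> \<open>At most \<open>R * R \<le> n\<close> nodes are used, so errors of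
    \<open>10 / n\<close> add up to at most 10, while \<open>harm R\<close> is still at least
    \<open>ln n / 2\<close>.\<close>
  define R where "R = nat \<lfloor>sqrt (real n)\<rfloor>"
  have Rle: "real R \<le> sqrt (real n)" and Rgt: "sqrt (real n) < real R + 1"
    unfolding R_def by (simp_all add: of_nat_nat)
  have "(real R)\<^sup>2 \<le> (sqrt (real n))\<^sup>2" by (rule power_mono[OF Rle]) simp
  then have "real R * real R \<le> real n" by (simp add: power2_eq_square)
  then have RR: "R * R \<le> n" by (simp flip: of_nat_mult)
  have "sqrt (real n) \<ge> sqrt 16" using n by (intro real_sqrt_le_mono) simp
  then have "sqrt (real n) \<ge> 4" by simp
  then have R4: "4 \<le> R" using Rgt by linarith
  have "4 * R \<le> R * R" using R4 by simp
  \<comment> \<open>Room for the largest indices: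
    \<open>a + 2 * y + 1 \<le> 3 * R + 1 \<le> n\<close>.\<close>
  then have R3: "4 * R \<le> n" using RR by linarith
  define S where "S = Sigma {1..R} (\<lambda>a. {1..a})"
  have "ln (real n) / 2 \<le> harm R"
  proof -
    have "ln (real n) / 2 = ln (sqrt (real n))" using n by (simp add: ln_sqrt)
    also have "\<dots> \<le> ln (real R + 1)" using Rgt n by (intro ln_mono) simp_all
    also have "\<dots> \<le> harm R" by (rule ln_le_harm)
    finally show ?thesis .
  qed
  moreover have "0 \<le> ln (real n) / 2" using n by simp
  ultimately have "(ln (real n) / 2)\<^sup>2 \<le> (harm R)\<^sup>2" by (rule power_mono)
  then have "(ln (real n))\<^sup>2 / 256 \<le> 1 / 32 * ((harm R)\<^sup>2 / 2)" by (simp add: power_divide)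
  also have "\<dots> \<le> 1 / 32 * (\<Sum>a=1..R. \<Sum>y=1..a. 1 / (real a * real y))"
    by (intro mult_left_mono triangular_harm_ge) simp
  also have "\<dots> = (\<Sum>a=1..R. \<Sum>y=1..a. 1 / (32 * real a * real y))"
    unfolding sum_distrib_left by (simp add: mult_ac)
  finally have main: "(ln (real n))\<^sup>2 / 256 \<le> (\<Sum>a=1..R. \<Sum>y=1..a. 1 / (32 * real a * real y))" .
  have err: "(\<Sum>a=1..R. \<Sum>y=1..a. 10 / real n) \<le> 10"
  proof -
    have "(\<Sum>a=1..R. \<Sum>y=1..a. 10 / real n) \<le> (\<Sum>a=1..R. real R * (10 / real n))"
      by (rule sum_mono) (auto intro!: divide_right_mono)
    also have "\<dots> = 10 * (real (R * R) / real n)" by simp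
    also have "\<dots> \<le> 10 * 1"
      using RR n by (intro mult_left_mono) (simp_all add: pos_divide_le_eq flip: of_nat_mult)
    finally show ?thesis by simp
  qed
  have "(ln (real n))\<^sup>2 / 256 - 10 \<le> (\<Sum>a=1..R. \<Sum>y=1..a. 1 / (32 * real a * real y) - 10 / real n)"
    unfolding sum_subtractf using main err by linarith
  also have "\<dots> \<le> (\<Sum>a=1..R. \<Sum>y=1..a. \<bar>lag m n (a, a + 2 * y) z\<bar>)"
    unfolding z_def using n nm R3 by (intro sum_mono abs_lag_corner_lower) auto
  also have "\<dots> = (\<Sum>(a, y)\<in>S. \<bar>lag m n (a, a + 2 * y) z\<bar>)"
    unfolding S_def by (rule sum.Sigma) auto
  also have "\<dots> = (\<Sum>k\<in>(\<lambda>(a, y). (a, a + 2 * y)) ` S. \<bar>lag m n k z\<bar>)"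
    by (subst sum.reindex) (auto simp: inj_on_def split_def)
  also have "\<dots> \<le> (\<Sum>k\<in>even_grid m n. \<bar>lag m n k z\<bar>)"
    using R3 nm by (intro sum_mono2 finite_even_grid) (auto simp: S_def even_grid_def)
  finally show ?thesis unfolding z_def .
qed

section \<open>Bounds for the Lebesgue constant\<close>

lemma lebesgue_const_eq:
  assumes "n > 0" "coprime n (n + p)"
  shows "lebesgue_const n p = (SUP z\<in>{-1..1} \<times> {-1..1}. \<Sum>k\<in>even_grid (n + p) n. \<bar>lag (n + p) n k z\<bar>)"
  unfolding lebesgue_const_def sum_LD[OF assms] ..

lemma lebesgue_const_upper:
  assumes n: "n > 0" and cop: "coprime n (n + p)"
  shows "lebesgue_const n p \<le> 408 * (1 + ln (real (n + p)))\<^sup>2"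
  unfolding lebesgue_const_eq[OF n cop]
  using n by (intro cSUP_least sum_abs_lag_le) auto

text \<open>The uniform estimate \<open>sum_abs_lag_le\<close> also supplies the boundedness that
  makes the supremum meaningful.\<close>

lemma lebesgue_const_ge:
  assumes n: "n > 0" and cop: "coprime n (n + p)" and z: "z \<in> {-1..1} \<times> {-1..1}"
  shows "(\<Sum>k\<in>even_grid (n + p) n. \<bar>lag (n + p) n k z\<bar>) \<le> lebesgue_const n p"
  unfolding lebesgue_const_eq[OF n cop]
  using n by (intro cSUP_upper[OF z] bdd_aboveI2[OF sum_abs_lag_le]) simp_all

text \<open>A fundamental polynomial equals 1 at its own node. This absorbs the additive loss of 10
  in the lower bound and covers small \<open>n\<close>.\<close>

lemma lebesgue_const_ge_1:
  assumes n: "n > 0" and cop: "coprime n (n + p)"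
  shows "1 \<le> lebesgue_const n p"
proof -
  define m where "m = n + p"
  have mn: "m > 0" "coprime m n" using n cop by (simp_all add: m_def coprime_commute)
  have z: "(0, 0) \<in> even_grid m n" by (simp add: even_grid_def)
  have "1 = \<bar>lag m n (0, 0) (node m n (0, 0))\<bar>" using lag_node[OF mn(2,1) n z z] by simp
  also have "\<dots> \<le> (\<Sum>k\<in>even_grid m n. \<bar>lag m n k (node m n (0, 0))\<bar>)"
    by (rule member_le_sum[OF z]) (simp_all add: finite_even_grid)
  also have "\<dots> \<le> lebesgue_const n p"
    unfolding m_def by (rule lebesgue_const_ge[OF n cop]) (simp add: node_def)
  finally show ?thesis .
qed

theorem theorem11:
  "\<exists>C D :: real. C > 0 \<and> D > 0 \<and>
     (\<forall>n p :: nat. n > 0 \<longrightarrow> p > 0 \<longrightarrow> coprime n (n + p) \<longrightarrow>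
        D * (ln (real n))\<^sup>2 \<le> lebesgue_const n p \<and>
        lebesgue_const n p \<le> C * (ln (real (n + p)))\<^sup>2)"
proof (rule exI[of _ 3672], rule exI[of _ "1 / 3000"], intro conjI allI impI)
  fix n p :: nat
  assume n: "n > 0" and p: "p > 0" and cop: "coprime n (n + p)"
  have "1 + ln (real (n + p)) \<le> 3 * ln (real (n + p))"
  proof -
    \<comment> \<open>As \<open>n + p\<close> is at least 2, its logarithm is at least 2/3 and
      absorbs the summand 1. The factor 3 enters squared: \<open>3672 = 9 * 408\<close>.\<close>
    have "ln 2 \<le> ln (real (n + p))" using n p by (intro ln_mono) simp_all
    then show ?thesis using ln2_ge_two_thirds by simp
  qed
  moreover have "0 \<le> 1 + ln (real (n + p))" using n by (simp add: add_nonneg_nonneg)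
  ultimately have "(1 + ln (real (n + p)))\<^sup>2 \<le> (3 * ln (real (n + p)))\<^sup>2" by (rule power_mono)
  then show "lebesgue_const n p \<le> 3672 * (ln (real (n + p)))\<^sup>2"
    using lebesgue_const_upper[OF n cop] by (simp add: power_mult_distrib)
  have ge1: "1 \<le> lebesgue_const n p" by (rule lebesgue_const_ge_1[OF n cop])
  show "1 / 3000 * (ln (real n))\<^sup>2 \<le> lebesgue_const n p"
  proof (cases "16 \<le> n")
    case True
    have "(ln (real n))\<^sup>2 / 256 - 10 \<le> (\<Sum>k\<in>even_grid (n + p) n. \<bar>lag (n + p) n k (1, cos (pi / real n))\<bar>)"
      using True p by (intro sum_abs_lag_corner_lower) simp_all
    also have "\<dots> \<le> lebesgue_const n p" by (rule lebesgue_const_ge[OF n cop]) simp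
    \<comment> \<open>With \<open>L\<close> for the Lebesgue constant, the square of
      \<open>ln n\<close> is at most \<open>256 * (L + 10)\<close>, hence at most
      \<open>2816 * L\<close> because \<open>1 \<le> L\<close>.\<close>
    finally show ?thesis using ge1 zero_le_power2[of "ln (real n)"] by linarith
  next
    case False
    have "ln (real n) \<le> real n" using n by (intro ln_bound) simp
    then have "ln (real n) \<le> 16" using False by linarith
    then have "(ln (real n))\<^sup>2 \<le> 16\<^sup>2" using n by (intro power_mono) simp_all
    then show ?thesis using ge1 by simp
  qed
qed simp_all

end
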